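(* Let $k,m\in\mathbb{N}$. Let $(X_k,\sigma)$ be the full $k$-shift and let $\varphi_1,\varphi_2$ be two automorphisms of $(X_k,\sigma)$ for which every orbit has size $m$. Then for all sufficiently large $\ell\in\mathbb{N}$ there is a homeomorphism $\psi:X_k\to X_k$ such that $\psi\circ\varphi_1=\varphi_2\circ\psi$ and $\psi\circ\sigma^\ell=\sigma^\ell\circ\psi$.
   Context: $\mathbb{N}=\{1,2,\dots\}$. The full $k$-shift is $X_k=\mathcal{S}^{\mathbb{Z}}$ with $|\mathcal{S}|=k$, with the product of discrete topologies and the left shift $\sigma(x)_i=x_{i+1}$. An automorphism of $(X_k,\sigma)$ is a homeomorphism $X_k\to X_k$ commuting with $\sigma$. The orbit of $x$ under $\varphi$ is $\{\varphi^n(x): n\in\mathbb{Z}\}$. *)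

theory Defs
  imports "HOL-Analysis.Analysis"
begin

definition full_shift :: "'a set \<Rightarrow> (int \<Rightarrow> 'a) topology" where
  "full_shift S = product_topology (\<lambda>_. discrete_topology S) UNIV"

definition shift :: "(int \<Rightarrow> 'a) \<Rightarrow> (int \<Rightarrow> 'a)" where
  "shift x = (\<lambda>i. x (i + 1))"

(* Maps of the full shift are total functions on int => 'a; only their values on
   the points of the shift space are constrained. *)
definition shift_automorphism :: "'a set \<Rightarrow> ((int \<Rightarrow> 'a) \<Rightarrow> (int \<Rightarrow> 'a)) \<Rightarrow> bool" where
  "shift_automorphism S \<phi> \<longleftrightarrow>
     homeomorphic_map (full_shift S) (full_shift S) \<phi> \<and>
     (\<forall>x \<in> topspace (full_shift S). \<phi> (shift x) = shift (\<phi> x))"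

(* Integer iterates of a bijection of X; the inverse is taken relative to X. *)
definition int_iterate :: "'b set \<Rightarrow> ('b \<Rightarrow> 'b) \<Rightarrow> int \<Rightarrow> 'b \<Rightarrow> 'b" where
  "int_iterate X f n = (if 0 \<le> n then f ^^ nat n else inv_into X f ^^ nat (- n))"

definition orbit_on :: "'b set \<Rightarrow> ('b \<Rightarrow> 'b) \<Rightarrow> 'b \<Rightarrow> 'b set" where
  "orbit_on X f x = {int_iterate X f n x | n. True}"

end

theory Submission
  imports Defs
begin

text \<open>Fix one automorphism \<open>\<phi>\<close>, choose \<open>r\<close> such that all powers of \<open>\<phi>\<close> are block codes of radius
  \<open>r\<close>, and call the values of \<open>x, \<phi> x, \<phi>\<^sup>2 x, \<dots>\<close> on \<open>[-r, r)\<close> the state of \<open>x\<close>. For large \<open>r\<close> the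
  automorphism acts freely on states, and past and future of a point are independent given its state.
  The values of these points on \<open>[-r, l + r)\<close> form a path between two states \<open>v\<close> and \<open>w\<close>, and
  there are \<open>A v * k ^ (l - 4r) * B w\<close> such paths, where \<open>A v\<close> and \<open>B w\<close> count the words of
  length \<open>r\<close> that may follow \<open>v\<close>, respectively precede \<open>w\<close>. As this number is invariant under \<open>\<phi>\<close>,
  so are \<open>A\<close> and \<open>B\<close>, and the paths can be labelled \<open>\<phi>\<close>-invariantly by triples \<open>(a, c, b)\<close> with
  \<open>a < A v\<close>, \<open>c < k ^ (l - 4r)\<close>, \<open>b < B w\<close>. Attaching \<open>b\<close> to the end state and \<open>(a, c)\<close> to the
  initial state conjugates \<open>\<sigma>\<^sup>l\<close> to the full shift on the symbols \<open>(v, b, a, c)\<close>, with \<open>\<phi>\<close> acting on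
  each symbol separately, through \<open>v\<close>. There are \<open>k\<^sup>l\<close> symbols, permuted in cycles of length \<open>m\<close>, so
  this model depends on \<open>k\<close>, \<open>l\<close> and \<open>m\<close> only.\<close>

section \<open>Free actions of a finite cyclic group\<close>

text \<open>A free action of Z/m written with forward iterates only: the case \<open>i = m\<close>
  gives \<open>(g ^^ m) y = y\<close>, so \<open>g\<close> is invertible on \<open>B\<close> without
  an inverse being named.\<close>

definition free_cyclic_on :: "nat \<Rightarrow> 'b set \<Rightarrow> ('b \<Rightarrow> 'b) \<Rightarrow> bool" where
  "free_cyclic_on m B g \<longleftrightarrow> 0 < m \<and> g ` B \<subseteq> B \<and> (\<forall>y\<in>B. \<forall>i. (g ^^ i) y = y \<longleftrightarrow> m dvd i)"

lemma funpow_in: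
  assumes "g ` B \<subseteq> B" "y \<in> B"
  shows "(g ^^ i) y \<in> B"
  using assms by (induction i) auto

lemma funpow_funpow: "(f ^^ i) ((f ^^ j) x) = (f ^^ (i + j)) x"
  by (simp add: funpow_add)

lemma free_cyclic_on_eqD:
  assumes "free_cyclic_on m B g" "y \<in> B" "(g ^^ i) y = (g ^^ j) y"
  shows "i mod m = j mod m"
proof -
  have *: "i mod m = j mod m" if "i \<le> j" "(g ^^ i) y = (g ^^ j) y" for i j
  proof -
    have m: "0 < m" using assms(1) by (simp add: free_cyclic_on_def)
    \<comment> \<open>The exponent \<open>m * i - i\<close> plays the role of \<open>-i\<close>: it
      is congruent to it modulo \<open>m\<close>, and this inequality keeps the natural subtraction
      from being cut off.\<close>
    then have n: "i \<le> m * i" by simp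
    have "(g ^^ (m * i - i)) ((g ^^ j) y) = (g ^^ (m * i - i)) ((g ^^ i) y)"
      using that by simp
    also have "\<dots> = (g ^^ (m * i)) y"
      by (simp only: funpow_funpow le_add_diff_inverse2[OF n])
    also have "\<dots> = y"
      using assms(1,2) by (simp add: free_cyclic_on_def)
    finally have "m dvd m * i - i + j"
      using assms(1,2) by (simp add: free_cyclic_on_def funpow_funpow)
    moreover have "m * i - i + j = m * i + (j - i)"
      using n that by linarith
    ultimately have "m dvd j - i"
      by (metis dvd_add_right_iff dvd_triv_left)
    then show ?thesis
      using that(1) mod_eq_dvd_iff_nat by metis
  qed
  show ?thesis
    using *[of i j] *[of j i] assms(3) by (metis nat_le_linear)
qed

lemma free_cyclic_on_mod:
  assumes "free_cyclic_on m B g" "y \<in> B"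
  shows "(g ^^ (i mod m)) y = (g ^^ i) y"
  by (rule funpow_mod_eq) (use assms in \<open>auto simp: free_cyclic_on_def\<close>)

lemma free_cyclic_on_eq_iff:
  assumes "free_cyclic_on m B g" "y \<in> B"
  shows "(g ^^ i) y = (g ^^ j) y \<longleftrightarrow> i mod m = j mod m"
  using free_cyclic_on_eqD[OF assms] free_cyclic_on_mod[OF assms] by metis

text \<open>Pick a base point in every orbit and count the steps from it. The result is an
  equivariant map to Z/m with its rotation.\<close>

lemma free_cyclic_on_position:
  assumes "free_cyclic_on m B g"
  obtains pos where "\<And>y. y \<in> B \<Longrightarrow> pos y < m" "\<And>y. y \<in> B \<Longrightarrow> pos (g y) = Suc (pos y) mod m"
proof -
  have m: "0 < m" and gB: "\<And>y. y \<in> B \<Longrightarrow> g y \<in> B"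
    using assms by (auto simp: free_cyclic_on_def)
  define orb where "orb y = {(g ^^ i) y | i. True}" for y
  \<comment> \<open>The choice depends on the set \<open>orb y\<close> alone, so it is constant
    along an orbit.\<close>
  define rep where "rep y = (SOME z. z \<in> orb y)" for y
  have rep_orb: "rep y \<in> orb y" for y
    unfolding rep_def by (rule someI[of _ y]) (auto simp: orb_def intro: exI[of _ 0])
  have orb_step: "orb (g y) = orb y" if "y \<in> B" for y
  proof (intro equalityI subsetI)
    fix z assume "z \<in> orb (g y)"
    then obtain i where "z = (g ^^ i) (g y)" by (auto simp: orb_def)
    then have "z = (g ^^ Suc i) y" by (simp add: funpow_swap1)
    then show "z \<in> orb y" unfolding orb_def by blast
  next
    fix z assume "z \<in> orb y"
    then obtain i where i: "z = (g ^^ i) y" by (auto simp: orb_def)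
    have "z = (g ^^ (i + m)) y"
      using i free_cyclic_on_eq_iff[OF assms that, of i "i + m"] by simp
    also have "i + m = Suc (i + m - 1)" using m by simp
    also have "(g ^^ \<dots>) y = (g ^^ (i + m - 1)) (g y)" by (simp add: funpow_swap1)
    finally show "z \<in> orb (g y)" unfolding orb_def by blast
  qed
  have rep_B: "rep y \<in> B" if "y \<in> B" for y
  proof -
    have "(g ^^ i) y \<in> B" for i
      by (rule funpow_in) (use gB that in auto)
    then show ?thesis using rep_orb[of y] by (auto simp: orb_def)
  qed
  define pos where "pos y = (SOME j. j < m \<and> (g ^^ j) (rep y) = y)" for y
  have pos: "pos y < m \<and> (g ^^ pos y) (rep y) = y" if y: "y \<in> B" for y
  proof -
    obtain i where i: "rep y = (g ^^ i) y" using rep_orb[of y] by (auto simp: orb_def)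
    \<comment> \<open>If \<open>i\<close> steps lead from \<open>y\<close> to the base point,
      \<open>j\<close> further steps close the cycle. When \<open>m\<close> divides \<open>i\<close>
      this is \<open>m\<close> rather than 0, hence the reduction \<open>j mod m\<close>
      below.\<close>
    define j where "j = m - i mod m"
    have "(g ^^ j) (rep y) = (g ^^ (j + i)) y" by (simp add: i funpow_add)
    also have "\<dots> = (g ^^ (j + i mod m)) y"
      using free_cyclic_on_eq_iff[OF assms y] by (simp add: mod_simps)
    also have "j + i mod m = m" using m by (simp add: j_def)
    also have "(g ^^ m) y = y" using assms y by (simp add: free_cyclic_on_def)
    finally have "(g ^^ (j mod m)) (rep y) = y"
      using free_cyclic_on_mod[OF assms rep_B[OF y]] by metis
    then have "j mod m < m \<and> (g ^^ (j mod m)) (rep y) = y" using m by simp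
    then show ?thesis unfolding pos_def by (rule someI)
  qed
  have "pos (g y) = Suc (pos y) mod m" if y: "y \<in> B" for y
  proof -
    have "rep (g y) = rep y" by (simp add: rep_def orb_step y)
    then have "(g ^^ pos (g y)) (rep y) = g y" using pos[OF gB[OF y]] by simp
    also have "\<dots> = (g ^^ Suc (pos y)) (rep y)" using pos[OF y] by simp
    finally show ?thesis
      using free_cyclic_on_eqD[OF assms rep_B[OF y]] pos[OF gB[OF y]] by (metis mod_less)
  qed
  with pos that show thesis by blast
qed

text \<open>Freeness on the base allows the fibres over position 0 of each orbit to be labelled
  arbitrarily; every other fibre is first carried there by a power of \<open>f\<close>. No two steps
  of an orbit of \<open>f\<close> can then demand different labels.\<close>

lemma invariant_labelling:
  fixes A :: "'b set" and D :: "'c \<Rightarrow> 'd set"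
  assumes base: "free_cyclic_on m B g"
    and f: "f ` A \<subseteq> A" "\<And>a. a \<in> A \<Longrightarrow> (f ^^ m) a = a"
    and p: "\<And>a. a \<in> A \<Longrightarrow> p a \<in> B" "\<And>a. a \<in> A \<Longrightarrow> p (f a) = g (p a)"
    and fin: "finite A" "\<And>y. y \<in> B \<Longrightarrow> finite (D y)"
    and D: "\<And>y. y \<in> B \<Longrightarrow> D (g y) = D y"
    and card: "\<And>y. y \<in> B \<Longrightarrow> card {a \<in> A. p a = y} = card (D y)"
  obtains lab where "\<And>a. a \<in> A \<Longrightarrow> lab (f a) = lab a"
    "\<And>y. y \<in> B \<Longrightarrow> bij_betw lab {a \<in> A. p a = y} (D y)"
proof -
  obtain pos where pos: "\<And>y. y \<in> B \<Longrightarrow> pos y < m"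
      "\<And>y. y \<in> B \<Longrightarrow> pos (g y) = Suc (pos y) mod m"
    using free_cyclic_on_position[OF base] by blast
  have m: "0 < m" and gB: "\<And>y. y \<in> B \<Longrightarrow> g y \<in> B"
    using base by (auto simp: free_cyclic_on_def)
  have fA: "(f ^^ i) a \<in> A" if "a \<in> A" for i a
    using funpow_in[OF f(1) that] .
  have gBi: "(g ^^ i) y \<in> B" if "y \<in> B" for i y
    using funpow_in[of g B y i] gB that by blast
  have pf: "p ((f ^^ i) a) = (g ^^ i) (p a)" if "a \<in> A" for i a
    by (induction i) (use that p fA in auto)
  have Di: "D ((g ^^ i) y) = D y" if "y \<in> B" for i y
    by (induction i) (use that D gBi in auto)
  have fmod: "(f ^^ i) a = (f ^^ j) a" if "a \<in> A" "i mod m = j mod m" for i j a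
    using funpow_mod_eq[OF f(2)[OF that(1)]] that(2) by metis
  have "\<exists>h. bij_betw h {a \<in> A. p a = y} (D y)" if "y \<in> B" for y
    using card[OF that] fin that by (intro finite_same_card_bij) auto
  then obtain h where h: "\<And>y. y \<in> B \<Longrightarrow> bij_betw (h y) {a \<in> A. p a = y} (D y)"
    by metis
  \<comment> \<open>This many steps lead on to the end of the cycle, that is, to position 0. At
    position 0 the value is \<open>m\<close>, a full turn, which is harmless since
    \<open>f ^^ m\<close> is the identity on \<open>A\<close>; therefore \<open>nstep\<close> is
    needed only modulo \<open>m\<close>.\<close>
  define n where "n y = m - pos y" for y
  define lab where "lab a = h ((g ^^ n (p a)) (p a)) ((f ^^ n (p a)) a)" for a
  have nstep: "(n (g y) + 1) mod m = n y mod m" if "y \<in> B" for y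
  proof (cases "Suc (pos y) < m")
    case True
    then show ?thesis using pos[OF that] by (simp add: n_def Suc_diff_Suc)
  next
    case False
    then have "Suc (pos y) = m" using pos(1)[OF that] by linarith
    then have "pos (g y) = 0" "n y = 1" using pos(2)[OF that] by (auto simp: n_def)
    moreover have "(m + 1) mod m = 1 mod m" by (rule mod_add_self1)
    ultimately show ?thesis by (simp add: n_def del: mod_add_self1)
  qed
  have "lab (f a) = lab a" if a: "a \<in> A" for a
  proof -
    have "(f ^^ n (p (f a))) (f a) = (f ^^ (n (g (p a)) + 1)) a"
      using p(2)[OF a] by (simp add: funpow_swap1)
    also have "\<dots> = (f ^^ n (p a)) a"
      by (rule fmod[OF a nstep[OF p(1)[OF a]]])
    finally have 1: "(f ^^ n (p (f a))) (f a) = (f ^^ n (p a)) a" .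
    have "(g ^^ n (p (f a))) (p (f a)) = p ((f ^^ n (p (f a))) (f a))"
      using pf[of "f a"] f(1) a by auto
    also have "\<dots> = (g ^^ n (p a)) (p a)"
      by (simp add: 1 pf a)
    finally show ?thesis by (simp add: lab_def 1)
  qed
  moreover have "bij_betw lab {a \<in> A. p a = y} (D y)" if y: "y \<in> B" for y
  proof -
    let ?i = "n y"
    have fb: "bij_betw (f ^^ ?i) {a \<in> A. p a = y} {a \<in> A. p a = (g ^^ ?i) y}"
    \<comment> \<open>Together with \<open>?i\<close> this exponent is a multiple of
      \<open>m\<close>, so it inverts \<open>f ^^ ?i\<close>.\<close>
    proof (rule bij_betw_byWitness[where f' = "f ^^ (m * ?i - ?i)"])
      have e: "m * ?i - ?i + ?i = ?i * m" using m by (simp add: mult.commute)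
      have e': "?i + (m * ?i - ?i) = ?i * m" using m by (simp add: mult.commute)
      show "\<forall>a\<in>{a \<in> A. p a = y}. (f ^^ (m * ?i - ?i)) ((f ^^ ?i) a) = a"
        using fmod[of _ "?i * m" 0] by (simp add: e funpow_funpow)
      show "\<forall>a\<in>{a \<in> A. p a = (g ^^ ?i) y}. (f ^^ ?i) ((f ^^ (m * ?i - ?i)) a) = a"
        using fmod[of _ "?i * m" 0] by (simp add: e' funpow_funpow)
      show "(f ^^ ?i) ` {a \<in> A. p a = y} \<subseteq> {a \<in> A. p a = (g ^^ ?i) y}"
        using fA pf by auto
      have "(g ^^ (m * ?i - ?i)) ((g ^^ ?i) y) = y"
        using free_cyclic_on_eq_iff[OF base y, of "?i * m" 0] by (simp add: e funpow_funpow)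
      then show "(f ^^ (m * ?i - ?i)) ` {a \<in> A. p a = (g ^^ ?i) y} \<subseteq> {a \<in> A. p a = y}"
        using fA pf by auto
    qed
    have "bij_betw (h ((g ^^ ?i) y) \<circ> (f ^^ ?i)) {a \<in> A. p a = y} (D ((g ^^ ?i) y))"
      by (rule bij_betw_trans[OF fb h[OF gBi[OF y]]])
    then show ?thesis
      using Di[OF y] by (subst bij_betw_cong[where g = "h ((g ^^ ?i) y) \<circ> (f ^^ ?i)"]) (auto simp: lab_def)
  qed
  ultimately show thesis using that by blast
qed

text \<open>\<open>f\<close> carries the fibre over \<open>y\<close> onto the fibre over
  \<open>g y\<close>, with inverse \<open>f ^^ (m - 1)\<close>.\<close>

lemma card_fiber_step:
  assumes base: "free_cyclic_on m B g"
    and f: "f ` A \<subseteq> A" "\<And>a. a \<in> A \<Longrightarrow> (f ^^ m) a = a"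
    and p: "\<And>a. a \<in> A \<Longrightarrow> p a \<in> B" "\<And>a. a \<in> A \<Longrightarrow> p (f a) = g (p a)"
    and y: "y \<in> B"
  shows "card {a \<in> A. p a = g y} = card {a \<in> A. p a = y}"
proof -
  have m_pos: "0 < m" and gm: "(g ^^ m) y = y"
    using base y by (auto simp: free_cyclic_on_def)
  have fA: "(f ^^ i) a \<in> A" if "a \<in> A" for i a
    using funpow_in[OF f(1) that] .
  have pf: "p ((f ^^ i) a) = (g ^^ i) (p a)" if "a \<in> A" for i a
    by (induction i) (use that p fA in auto)
  have step: "(h ^^ (m - 1)) (h b) = (h ^^ m) b" "h ((h ^^ (m - 1)) b) = (h ^^ m) b"
    for b and h :: "'x \<Rightarrow> 'x"
    using m_pos by (cases m; simp add: funpow_swap1)+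
  have "bij_betw f {a \<in> A. p a = y} {a \<in> A. p a = g y}"
  proof (rule bij_betw_byWitness[where f' = "f ^^ (m - 1)"])
    show "(f ^^ (m - 1)) ` {a \<in> A. p a = g y} \<subseteq> {a \<in> A. p a = y}"
      using fA pf gm step(1)[of g y] by auto
  qed (use f p step[of f] in auto)
  then show ?thesis by (simp add: bij_betw_same_card)
qed

text \<open>The common model on symbols: the first coordinate is the place in an
  \<open>m\<close>-cycle, the second tells the cycles apart.\<close>

definition rotate_symbol :: "nat \<Rightarrow> nat \<times> 'b \<Rightarrow> nat \<times> 'b" where
  "rotate_symbol m = map_prod (\<lambda>i. Suc i mod m) id"

section \<open>The full shift\<close>

abbreviation points :: "'a set \<Rightarrow> (int \<Rightarrow> 'a) set" where
  "points S \<equiv> topspace (full_shift S)"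

lemma mem_points_iff: "x \<in> points S \<longleftrightarrow> (\<forall>i. x i \<in> S)"
  by (auto simp: full_shift_def PiE_iff)

text \<open>Covers all integer powers of \<open>shift\<close> without inverting it.\<close>

definition translate :: "int \<Rightarrow> (int \<Rightarrow> 'a) \<Rightarrow> (int \<Rightarrow> 'a)" where
  "translate n x = (\<lambda>i. x (i + n))"

lemma translate_apply [simp]: "translate n x i = x (i + n)"
  by (simp add: translate_def)

lemma translate_translate [simp]: "translate a (translate b x) = translate (a + b) x"
  by (auto simp: translate_def algebra_simps)

lemma translate_0 [simp]: "translate 0 x = x"
  by (auto simp: translate_def)

lemma shift_eq_translate: "shift = translate 1"
  by (auto simp: shift_def translate_def)

lemma shift_funpow: "(shift ^^ n) = translate (int n)"
  by (induction n) (auto simp: shift_eq_translate translate_def algebra_simps)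

lemma translate_points [simp]: "translate n x \<in> points S \<longleftrightarrow> x \<in> points S"
  unfolding mem_points_iff translate_apply by (metis diff_add_cancel)

section \<open>Cylinder sets and compactness\<close>

definition agree :: "nat \<Rightarrow> (int \<Rightarrow> 'a) \<Rightarrow> (int \<Rightarrow> 'a) \<Rightarrow> bool" where
  "agree n x y \<longleftrightarrow> (\<forall>t. \<bar>t\<bar> \<le> int n \<longrightarrow> x t = y t)"

lemma openin_cylinder:
  assumes "x \<in> points S"
  shows "openin (full_shift S) {y \<in> points S. agree n x y}"
proof -
  have "{y \<in> points S. agree n x y} = (\<Pi>\<^sub>E t\<in>UNIV. if \<bar>t\<bar> \<le> int n then {x t} else S)"
    (is "?C = ?P")
  proof (intro equalityI subsetI)
    fix y assume y: "y \<in> ?P"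
    have "y t \<in> (if \<bar>t\<bar> \<le> int n then {x t} else S)" for t
      using y by (rule PiE_mem) simp
    then have "y t \<in> S" "\<bar>t\<bar> \<le> int n \<Longrightarrow> x t = y t" for t
      using assms by (metis mem_points_iff singletonD, metis singletonD)
    then show "y \<in> ?C"
      by (simp add: mem_points_iff agree_def)
  qed (use assms in \<open>auto simp: mem_points_iff agree_def\<close>)
  moreover have "openin (full_shift S) (\<Pi>\<^sub>E t\<in>UNIV. if \<bar>t\<bar> \<le> int n then {x t} else S)"
    unfolding full_shift_def
  proof (rule product_topology_basis)
    show "openin (discrete_topology S) (if \<bar>t\<bar> \<le> int n then {x t} else S)" for t
      using assms by (simp add: mem_points_iff)
    have "{t. (if \<bar>t\<bar> \<le> int n then {x t} else S) \<noteq> topspace (discrete_topology S)} \<subseteq> {- int n..int n}"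
      by auto
    then show "finite {t. (if \<bar>t\<bar> \<le> int n then {x t} else S) \<noteq> topspace (discrete_topology S)}"
      by (rule finite_subset) simp
  qed
  ultimately show ?thesis by simp
qed

text \<open>A basic open set of the product restricts finitely many coordinates, and these lie in
  some central window.\<close>

lemma openin_full_shift_cylinder:
  assumes "openin (full_shift S) U" "x \<in> U"
  shows "\<exists>n. \<forall>y\<in>points S. agree n x y \<longrightarrow> y \<in> U"
proof -
  obtain W where W: "x \<in> (\<Pi>\<^sub>E i\<in>UNIV. W i)" "finite {i. W i \<noteq> S}" "(\<Pi>\<^sub>E i\<in>UNIV. W i) \<subseteq> U"
    using product_topology_open_contains_basis[OF assms[unfolded full_shift_def]] by auto
  \<comment> \<open>Inserting 0 keeps the maximum meaningful when no coordinate is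
    restricted.\<close>
  let ?n = "Max (insert 0 ((\<lambda>i. nat \<bar>i\<bar>) ` {i. W i \<noteq> S}))"
  have n: "\<bar>i\<bar> \<le> int ?n" if "W i \<noteq> S" for i
  proof -
    have "nat \<bar>i\<bar> \<le> ?n" using W(2) that by (intro Max_ge) auto
    then show ?thesis by linarith
  qed
  have "y \<in> U" if y: "y \<in> points S" "agree ?n x y" for y
  proof -
    have "y i \<in> W i" for i
    proof (cases "W i = S")
      case True
      then show ?thesis using y(1) by (simp add: mem_points_iff)
    next
      case False
      then have "x i = y i" using n y(2) by (simp add: agree_def)
      then show ?thesis using W(1) by (metis PiE_mem UNIV_I)
    qed
    then show ?thesis using W(3) by (auto simp: PiE_iff)
  qed
  then show ?thesis by blast
qed

lemma compact_full_shift: "finite S \<Longrightarrow> compact_space (full_shift S)"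
  by (simp add: full_shift_def compact_space_product_topology compact_space_discrete_topology)

lemma Hausdorff_full_shift: "Hausdorff_space (full_shift S)"
  by (simp add: full_shift_def Hausdorff_space_product_topology)

text \<open>Compactness turns local bounds into a global one: take the maximum over a finite
  subcover by cylinders, which monotonicity permits. It yields both the radius of a block code and a
  uniform bound on where a fixed-point-free power moves a coordinate.\<close>

lemma uniform_on_full_shift:
  assumes "finite S"
    and loc: "\<And>x. x \<in> points S \<Longrightarrow> \<exists>n. \<forall>y\<in>points S. agree n x y \<longrightarrow> Q n y"
    and mono: "\<And>n n' y. Q n y \<Longrightarrow> n \<le> n' \<Longrightarrow> Q n' y"
  shows "\<exists>n. \<forall>y\<in>points S. Q n y"
proof -
  obtain n where n: "\<And>x y. x \<in> points S \<Longrightarrow> y \<in> points S \<Longrightarrow> agree (n x) x y \<Longrightarrow> Q (n x) y"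
    using loc by metis
  define C where "C x = {y \<in> points S. agree (n x) x y}" for x
  have "\<forall>U\<in>C ` points S. openin (full_shift S) U" "points S \<subseteq> \<Union>(C ` points S)"
    by (auto simp: C_def openin_cylinder) (auto simp: agree_def)
  then obtain \<F> where \<F>: "finite \<F>" "\<F> \<subseteq> C ` points S" "points S \<subseteq> \<Union>\<F>"
    using compact_full_shift[OF assms(1)] unfolding compact_space_alt by meson
  obtain F where F: "finite F" "F \<subseteq> points S" "points S \<subseteq> \<Union>(C ` F)"
    using finite_subset_image[OF \<F>(1,2)] \<F>(3) by blast
  have "Q (Max (insert 0 (n ` F))) y" if "y \<in> points S" for y
  proof -
    obtain x where x: "x \<in> F" "y \<in> C x" using F(3) \<open>y \<in> points S\<close> by blast
    then have "Q (n x) y" using n[of x y] F(2) by (auto simp: C_def)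
    then show ?thesis by (rule mono) (use F(1) x(1) in \<open>auto intro: Max_ge\<close>)
  qed
  then show ?thesis by blast
qed

lemma continuous_map_full_shiftI:
  assumes "\<And>x. x \<in> points S \<Longrightarrow> f x \<in> points T"
    and loc: "\<And>j. \<exists>n. \<forall>x\<in>points S. \<forall>y\<in>points S. agree n x y \<longrightarrow> f x j = f y j"
  shows "continuous_map (full_shift S) (full_shift T) f"
proof -
  have "continuous_map (full_shift S) (discrete_topology T) (\<lambda>x. f x j)" for j
    unfolding continuous_map_def
  proof (intro conjI allI impI)
    show "(\<lambda>x. f x j) \<in> points S \<rightarrow> topspace (discrete_topology T)"
      using assms(1) by (auto simp: mem_points_iff)
    fix U assume "openin (discrete_topology T) U"
    obtain n where n: "\<And>x y. x \<in> points S \<Longrightarrow> y \<in> points S \<Longrightarrow> agree n x y \<Longrightarrow> f x j = f y j"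
      using loc by metis
    show "openin (full_shift S) {x \<in> points S. f x j \<in> U}"
    proof (subst openin_subopen, intro ballI)
      fix x assume x: "x \<in> {x \<in> points S. f x j \<in> U}"
      show "\<exists>C. openin (full_shift S) C \<and> x \<in> C \<and> C \<subseteq> {x \<in> points S. f x j \<in> U}"
      proof (intro exI conjI)
        show "openin (full_shift S) {y \<in> points S. agree n x y}"
          using x by (auto intro: openin_cylinder)
        show "{y \<in> points S. agree n x y} \<subseteq> {x \<in> points S. f x j \<in> U}"
        proof
          fix y assume "y \<in> {y \<in> points S. agree n x y}"
          then show "y \<in> {x \<in> points S. f x j \<in> U}" using x n[of x y] by auto
        qed
      qed (use x in \<open>auto simp: agree_def\<close>)
    qed
  qed
  then show ?thesis
    by (simp add: full_shift_def[of T] continuous_map_componentwise_UNIV)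
qed

section \<open>Sliding block codes, orbits and periodic points\<close>

lemma commute_translate:
  assumes com: "\<And>x. x \<in> points S \<Longrightarrow> f (shift x) = shift (f x)" and x: "x \<in> points S"
  shows "f (translate n x) = translate n (f x)"
proof -
  have nat: "f (translate (int k) x) = translate (int k) (f x)" if "x \<in> points S" for k x
  proof (induction k)
    case (Suc k)
    have "translate (int (Suc k)) x = shift (translate (int k) x)"
      by (simp add: shift_eq_translate)
    then have "f (translate (int (Suc k)) x) = shift (f (translate (int k) x))"
      using com[of "translate (int k) x"] that by simp
    also have "\<dots> = translate (int (Suc k)) (f x)"
      unfolding Suc shift_eq_translate translate_translate by simp
    finally show ?case .
  qed simp
  show ?thesis
  proof (cases "n \<ge> 0")
    case True
    then show ?thesis using nat[OF x, of "nat n"] by simp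
  next
    case False
    then have "f x = translate (- n) (f (translate n x))"
      using nat[of "translate n x" "nat (- n)"] x by simp
    then show ?thesis by simp
  qed
qed

text \<open>The Curtis-Hedlund-Lyndon theorem: continuity and compactness give a radius at
  coordinate 0, and commutation with the shift moves it to every coordinate.\<close>

lemma sliding_block_window:
  assumes "finite S" and cont: "continuous_map (full_shift S) (full_shift S) f"
    and com: "\<And>x. x \<in> points S \<Longrightarrow> f (shift x) = shift (f x)"
  shows "\<exists>n. \<forall>x\<in>points S. \<forall>y\<in>points S. \<forall>t.
    (\<forall>s\<in>{t - int n..t + int n}. x s = y s) \<longrightarrow> f x t = f y t"
proof -
  \<comment> \<open>Centred at \<open>y\<close> itself, so that the property is monotone in
    \<open>n\<close> and passes from \<open>x\<close> to all points of a cylinder around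
    \<open>x\<close>.\<close>
  define Q where "Q n y \<longleftrightarrow> (\<forall>z\<in>points S. agree n y z \<longrightarrow> f y 0 = f z 0)" for n y
  have "\<exists>n. \<forall>y\<in>points S. agree n x y \<longrightarrow> Q n y" if x: "x \<in> points S" for x
  proof -
    have "continuous_map (full_shift S) (discrete_topology S) (\<lambda>x. f x 0)"
      using cont by (simp add: full_shift_def[of S] continuous_map_componentwise_UNIV)
    moreover have "f x 0 \<in> S"
      using cont x by (auto simp: continuous_map_def mem_points_iff Pi_iff)
    ultimately have "openin (full_shift S) {y \<in> points S. f y 0 \<in> {f x 0}}"
      using openin_continuous_map_preimage[of "full_shift S" "discrete_topology S" "\<lambda>x. f x 0" "{f x 0}"]
      by simp
    then obtain n where n: "\<forall>y\<in>points S. agree n x y \<longrightarrow> f y 0 = f x 0"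
      using openin_full_shift_cylinder[of S "{y \<in> points S. f y 0 \<in> {f x 0}}" x] x by fastforce
    have "Q n y" if "y \<in> points S" "agree n x y" for y
      using n that by (auto simp: Q_def agree_def)
    then show ?thesis by blast
  qed
  moreover have "Q n' y" if "Q n y" "n \<le> n'" for n n' y
    using that by (auto simp: Q_def agree_def)
  ultimately obtain n where n: "\<forall>y\<in>points S. Q n y"
    using uniform_on_full_shift[OF assms(1), of Q] by blast
  have "f x t = f y t"
    if "x \<in> points S" "y \<in> points S" "\<forall>s\<in>{t - int n..t + int n}. x s = y s" for x y t
  proof -
    have "agree n (translate t x) (translate t y)"
      unfolding agree_def by (auto intro!: bspec[OF that(3)])
    then have "f (translate t x) 0 = f (translate t y) 0"
      using bspec[OF n, of "translate t x"] that by (simp add: Q_def)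
    then show ?thesis
      using commute_translate[of S f x t] commute_translate[of S f y t] com that by simp
  qed
  then show ?thesis by blast
qed

text \<open>A finite orbit forces two forward iterates to coincide, and injectivity turns this into
  a return to \<open>x\<close>. If \<open>d\<close> is the least return time, the two-sided orbit
  consists of exactly \<open>d\<close> points, whence \<open>d = m\<close>.\<close>

lemma funpow_eq_iff_dvd_card_orbit:
  assumes bij: "bij_betw f X X" and x: "x \<in> X" and card: "card (orbit_on X f x) = m" and "0 < m"
  shows "(f ^^ i) x = x \<longleftrightarrow> m dvd i"
proof -
  have fX: "(f ^^ i) x \<in> X" for i
    by (rule funpow_in) (use bij x in \<open>auto simp: bij_betw_def\<close>)
  have inj: "inj_on (f ^^ i) X" for i
    using bij_betw_funpow[OF bij] by (auto simp: bij_betw_def)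
  have fin: "finite (orbit_on X f x)"
    using card \<open>0 < m\<close> card_ge_0_finite by auto
  have "range (\<lambda>i. (f ^^ i) x) \<subseteq> orbit_on X f x"
  proof clarify
    fix i show "(f ^^ i) x \<in> orbit_on X f x"
      unfolding orbit_on_def by (intro CollectI exI[of _ "int i"]) (simp add: int_iterate_def)
  qed
  then have "\<not> inj (\<lambda>i. (f ^^ i) x)"
    using fin finite_subset finite_imageD infinite_UNIV_nat by metis
  then obtain a b where ab: "a < b" "(f ^^ a) x = (f ^^ b) x"
    unfolding inj_def by (metis linorder_neqE_nat)
  have "(f ^^ a) ((f ^^ (b - a)) x) = (f ^^ a) x"
    using ab by (simp add: funpow_funpow)
  then have ba: "(f ^^ (b - a)) x = x"
    using inj_onD[OF inj] fX x by metis
  define d where "d = (LEAST d. 0 < d \<and> (f ^^ d) x = x)"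
  have d: "0 < d \<and> (f ^^ d) x = x"
    unfolding d_def by (rule LeastI[of _ "b - a"]) (use ab ba in simp)
  have d_least: "d \<le> e" if "0 < e" "(f ^^ e) x = x" for e
    unfolding d_def by (rule Least_le) (use that in simp)
  have dmod: "(f ^^ i) x = (f ^^ (i mod d)) x" for i
    using funpow_mod_eq d by metis
  have per: "(f ^^ i) x = x \<longleftrightarrow> d dvd i" for i
  proof
    assume "(f ^^ i) x = x"
    then have "(f ^^ (i mod d)) x = x" using dmod by simp
    then have "\<not> 0 < i mod d" using d_least d by (metis mod_less_divisor not_le)
    then show "d dvd i" by auto
  next
    assume "d dvd i"
    then have "i mod d = 0" by simp
    then show "(f ^^ i) x = x" using dmod[of i] by simp
  qed
  \<comment> \<open>One step back is \<open>d - 1\<close> steps forward, so negative iterates add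
    nothing to the orbit.\<close>
  have inv: "(inv_into X f ^^ i) x = (f ^^ ((d - 1) * i)) x" for i
  proof (induction i)
    case (Suc i)
    have "f ((f ^^ ((d - 1) * Suc i)) x) = (f ^^ (d + (d - 1) * i)) x"
      using d by (cases d) (auto simp: algebra_simps)
    also have "\<dots> = (f ^^ ((d - 1) * i)) x"
      by (subst (1 2) dmod) simp
    finally have "inv_into X f ((f ^^ ((d - 1) * i)) x) = (f ^^ ((d - 1) * Suc i)) x"
      using fX bij by (metis bij_betw_def inv_into_f_f)
    with Suc show ?case by simp
  qed simp
  have "orbit_on X f x = (\<lambda>i. (f ^^ i) x) ` {..<d}"
  proof (intro equalityI subsetI)
    fix y assume "y \<in> orbit_on X f x"
    then obtain n where "y = int_iterate X f n x" by (auto simp: orbit_on_def)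
    then obtain i where "y = (f ^^ i) x" by (metis int_iterate_def inv)
    then have "y = (f ^^ (i mod d)) x" using dmod by metis
    then show "y \<in> (\<lambda>i. (f ^^ i) x) ` {..<d}" using d by auto
  next
    fix y assume "y \<in> (\<lambda>i. (f ^^ i) x) ` {..<d}"
    then show "y \<in> orbit_on X f x"
      using \<open>range (\<lambda>i. (f ^^ i) x) \<subseteq> orbit_on X f x\<close> by auto
  qed
  moreover have "inj_on (\<lambda>i. (f ^^ i) x) {..<d}"
  proof (rule linorder_inj_onI)
    fix a b assume ab: "a < b" "a \<in> {..<d}" "b \<in> {..<d}"
    show "(f ^^ a) x \<noteq> (f ^^ b) x"
    proof
      assume "(f ^^ a) x = (f ^^ b) x"
      then have "(f ^^ a) ((f ^^ (b - a)) x) = (f ^^ a) x"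
        using ab by (simp add: funpow_funpow)
      then have "(f ^^ (b - a)) x = x"
        using inj_onD[OF inj] fX x by metis
      then show False using d_least[of "b - a"] ab by auto
    qed
  qed auto
  ultimately have "d = m" using card by (simp add: card_image)
  then show ?thesis using per by simp
qed

text \<open>A continuous bijection from a compact space to a Hausdorff space is a homeomorphism, so
  no locality of the inverse has to be shown.\<close>

lemma homeomorphic_map_full_shiftI:
  assumes "finite S" "bij_betw f (points S) (points T)"
    and "\<And>j. \<exists>n. \<forall>x\<in>points S. \<forall>y\<in>points S. agree n x y \<longrightarrow> f x j = f y j"
  shows "homeomorphic_map (full_shift S) (full_shift T) f"
proof (rule continuous_imp_homeomorphic_map)
  show "continuous_map (full_shift S) (full_shift T) f"
    by (rule continuous_map_full_shiftI) (use assms(2,3) in \<open>auto simp: bij_betw_def\<close>)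
qed (use assms in \<open>auto simp: compact_full_shift Hausdorff_full_shift bij_betw_def\<close>)

text \<open>A point of period \<open>n\<close> is the periodic repetition of an arbitrary word on
  [0, n).\<close>

lemma card_periodic_points:
  assumes "finite S" "0 < n"
  shows "card {x \<in> points S. translate (int n) x = x} = card S ^ n"
proof -
  let ?P = "{x \<in> points S. translate (int n) x = x}" and ?W = "\<Pi>\<^sub>E t\<in>{0..<int n}. S"
  have per: "x (t + int n * q) = x t" if "translate (int n) x = x" for x :: "int \<Rightarrow> 'a" and t q
  proof -
    have step: "x (t + int n) = x t" for t
      using that by (metis translate_apply)
    show ?thesis
    proof (induction q rule: int_induct[where k = 0])
      case (step1 i)
      then show ?case using step[of "t + int n * i"] by (simp add: algebra_simps)
    next
      case (step2 i)
      then show ?case using step[of "t + int n * (i - 1)"] by (simp add: algebra_simps)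
    qed simp
  qed
  have "bij_betw (\<lambda>x. restrict x {0..<int n}) ?P ?W"
  proof (rule bij_betw_byWitness[where f' = "\<lambda>w t. w (t mod int n)"])
    show "\<forall>x\<in>?P. (\<lambda>t. restrict x {0..<int n} (t mod int n)) = x"
    proof (intro ballI ext)
      fix x t assume "x \<in> ?P"
      then have "x (t mod int n + int n * (t div int n)) = x (t mod int n)"
        by (intro per) simp
      then show "restrict x {0..<int n} (t mod int n) = x t"
        using assms(2) by (simp add: mod_mult_div_eq)
    qed
    show "\<forall>w\<in>?W. (\<lambda>t\<in>{0..<int n}. w (t mod int n)) = w"
      by (auto simp: PiE_def extensional_def fun_eq_iff)
    show "(\<lambda>x. restrict x {0..<int n}) ` ?P \<subseteq> ?W"
      by (auto simp: mem_points_iff)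
    show "(\<lambda>w t. w (t mod int n)) ` ?W \<subseteq> ?P"
      using assms(2) by (auto simp: mem_points_iff translate_def PiE_iff)
  qed
  then have "card ?P = card ?W" by (rule bij_betw_same_card)
  also have "\<dots> = card S ^ n" by (simp add: card_PiE)
  finally show ?thesis .
qed

section \<open>States and paths\<close>

lemma restrict_eqD: "restrict f A = restrict g A \<Longrightarrow> t \<in> A \<Longrightarrow> f t = g t"
  by (metis restrict_apply')

text \<open>What remains of an automorphism once a radius is chosen: \<open>window\<close> holds for
  all powers with the same \<open>r\<close>, and \<open>free\<close> says that a power which is not
  the identity can be detected on [-r, r).\<close>

locale cyclic_shift_action =
  fixes S :: "'a set" and m :: nat and \<phi> :: "(int \<Rightarrow> 'a) \<Rightarrow> (int \<Rightarrow> 'a)" and r :: int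
  assumes finite_S: "finite S" and S_nonempty: "S \<noteq> {}" and m_pos: "0 < m" and r_pos: "0 < r"
    and in_points: "x \<in> points S \<Longrightarrow> \<phi> x \<in> points S"
    and commute: "x \<in> points S \<Longrightarrow> \<phi> (translate n x) = translate n (\<phi> x)"
    and period: "x \<in> points S \<Longrightarrow> (\<phi> ^^ m) x = x"
    and window: "\<lbrakk>x \<in> points S; y \<in> points S; \<forall>s\<in>{t - r..t + r}. x s = y s\<rbrakk>
      \<Longrightarrow> (\<phi> ^^ i) x t = (\<phi> ^^ i) y t"
    and free: "\<lbrakk>x \<in> points S; \<forall>t\<in>{-r..<r}. (\<phi> ^^ i) x t = x t\<rbrakk> \<Longrightarrow> m dvd i"
begin

lemma funpow_points [simp]: "x \<in> points S \<Longrightarrow> (\<phi> ^^ i) x \<in> points S"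
  by (rule funpow_in) (auto simp: in_points)

lemma funpow_commute: "x \<in> points S \<Longrightarrow> (\<phi> ^^ i) (translate n x) = translate n ((\<phi> ^^ i) x)"
  by (induction i) (auto simp: commute)

lemma funpow_period:
  assumes "x \<in> points S" "m dvd i"
  shows "(\<phi> ^^ i) x = x"
proof -
  have "(\<phi> ^^ (i mod m)) x = (\<phi> ^^ i) x"
    by (rule funpow_mod_eq) (use assms period in auto)
  then show ?thesis using assms(2) by simp
qed

text \<open>Row \<open>i\<close> shows the \<open>i\<close>-th iterate. All rows are kept, although
  they repeat with period \<open>m\<close>, so that \<phi> becomes a mere shift of the row
  index.\<close>

definition block :: "int \<Rightarrow> int \<Rightarrow> (int \<Rightarrow> 'a) \<Rightarrow> nat \<Rightarrow> int \<Rightarrow> 'a" where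
  "block a b x = (\<lambda>i. restrict ((\<phi> ^^ i) x) {a..<b})"

definition rot :: "(nat \<Rightarrow> int \<Rightarrow> 'a) \<Rightarrow> nat \<Rightarrow> int \<Rightarrow> 'a" where
  "rot w = (\<lambda>i. w (Suc i))"

lemma block_eq_iff:
  "block a b x = block a b y \<longleftrightarrow> (\<forall>i. \<forall>t\<in>{a..<b}. (\<phi> ^^ i) x t = (\<phi> ^^ i) y t)"
  unfolding block_def fun_eq_iff restrict_def by auto

lemma block_eqD: "\<lbrakk>block a b x = block a b y; a \<le> t; t < b\<rbrakk> \<Longrightarrow> (\<phi> ^^ i) x t = (\<phi> ^^ i) y t"
  by (simp add: block_eq_iff)

lemma block_eqI:
  assumes "x \<in> points S" "y \<in> points S" "\<And>t. \<lbrakk>a - r \<le> t; t < b + r\<rbrakk> \<Longrightarrow> x t = y t"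
  shows "block a b x = block a b y"
  unfolding block_eq_iff using assms by (auto intro!: window)

text \<open>By \<open>window\<close> a block depends only on the coordinates in [a - r, b + r);
  outside, the point may be replaced by a fixed symbol \<open>s\<close>.\<close>

lemma finite_blocks: "finite (block a b ` points S)"
proof -
  obtain s where s: "s \<in> S" using S_nonempty by blast
  let ?W = "{a - r..<b + r}"
  have "block a b ` points S \<subseteq> (\<lambda>w. block a b (\<lambda>t. if t \<in> ?W then w t else s)) ` (\<Pi>\<^sub>E t\<in>?W. S)"
  proof
    fix w assume "w \<in> block a b ` points S"
    then obtain x where x: "x \<in> points S" "w = block a b x" by blast
    have "w = block a b (\<lambda>t. if t \<in> ?W then restrict x ?W t else s)"
      unfolding x(2) by (rule block_eqI) (use x s in \<open>auto simp: mem_points_iff\<close>)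
    moreover have "restrict x ?W \<in> (\<Pi>\<^sub>E t\<in>?W. S)"
      using x by (auto simp: mem_points_iff)
    ultimately show "w \<in> (\<lambda>w. block a b (\<lambda>t. if t \<in> ?W then w t else s)) ` (\<Pi>\<^sub>E t\<in>?W. S)"
      by blast
  qed
  then show ?thesis
    by (rule finite_subset) (simp add: finite_PiE finite_S)
qed

lemma rot_block: "rot (block a b x) = block a b (\<phi> x)"
  by (auto simp: rot_def block_def funpow_swap1 fun_eq_iff)

lemma rot_funpow_block: "(rot ^^ i) (block a b x) = block a b ((\<phi> ^^ i) x)"
  by (induction i) (auto simp: rot_block)

definition states :: "(nat \<Rightarrow> int \<Rightarrow> 'a) set" where
  "states = block (-r) r ` points S"

lemma free_cyclic_states: "free_cyclic_on m states rot"
  unfolding free_cyclic_on_def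
proof (intro conjI ballI allI)
  show "rot ` states \<subseteq> states"
    by (auto simp: states_def rot_block in_points)
  fix v i assume "v \<in> states"
  then obtain x where x: "x \<in> points S" "v = block (-r) r x" by (auto simp: states_def)
  show "(rot ^^ i) v = v \<longleftrightarrow> m dvd i"
  proof
    assume "(rot ^^ i) v = v"
    then have "block (-r) r ((\<phi> ^^ i) x) = block (-r) r x"
      by (simp add: x rot_funpow_block)
    \<comment> \<open>Row 0 already says that the \<open>i\<close>-th iterate agrees with
      \<open>x\<close> on [-r, r), which is the hypothesis of \<open>free\<close>.\<close>
    from block_eqD[OF this, of _ 0] show "m dvd i"
      by (intro free[OF x(1)]) auto
  next
    assume "m dvd i"
    then show "(rot ^^ i) v = v"
      by (simp add: x rot_funpow_block funpow_period)
  qed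
qed (rule m_pos)

lemma finite_states: "finite states"
  by (simp add: states_def finite_blocks)

text \<open>The state depends on the coordinates in [-2r, 2r) only. Hence it constrains the future
  beyond [-r, r) through the next \<open>r\<close> symbols and not further; \<open>before\<close> is
  the mirror image.\<close>

definition after :: "(nat \<Rightarrow> int \<Rightarrow> 'a) \<Rightarrow> (int \<Rightarrow> 'a) set" where
  "after v = (\<lambda>x. restrict x {r..<2*r}) ` {x \<in> points S. block (-r) r x = v}"

definition before :: "(nat \<Rightarrow> int \<Rightarrow> 'a) \<Rightarrow> (int \<Rightarrow> 'a) set" where
  "before v = (\<lambda>x. restrict x {-2*r..<-r}) ` {x \<in> points S. block (-r) r x = v}"

lemma finite_after: "finite (after v)"
proof (rule finite_subset)
  show "after v \<subseteq> (\<Pi>\<^sub>E t\<in>{r..<2*r}. S)"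
    by (auto simp: after_def mem_points_iff)
qed (simp add: finite_PiE finite_S)

lemma finite_before: "finite (before v)"
proof (rule finite_subset)
  show "before v \<subseteq> (\<Pi>\<^sub>E t\<in>{-2*r..<-r}. S)"
    by (auto simp: before_def mem_points_iff)
qed (simp add: finite_PiE finite_S)

lemma card_after_pos: "v \<in> states \<Longrightarrow> 0 < card (after v)"
  by (auto simp: card_gt_0_iff finite_after) (auto simp: after_def states_def)

lemma card_before_pos: "v \<in> states \<Longrightarrow> 0 < card (before v)"
  by (auto simp: card_gt_0_iff finite_before) (auto simp: before_def states_def)

end

text \<open>The bound makes the windows [-2r, 2r) and [l - 2r, l + 2r), which determine the two end
  states of a path, disjoint.\<close>

locale cyclic_shift_action_power = cyclic_shift_action +
  fixes l :: nat
  assumes l_ge: "4 * r \<le> int l"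
begin

abbreviation L :: int where "L \<equiv> int l"

definition path :: "(int \<Rightarrow> 'a) \<Rightarrow> nat \<Rightarrow> int \<Rightarrow> 'a" where
  "path = block (-r) (L + r)"

definition paths :: "(nat \<Rightarrow> int \<Rightarrow> 'a) set" where
  "paths = path ` points S"

definition ends :: "(nat \<Rightarrow> int \<Rightarrow> 'a) \<Rightarrow> (nat \<Rightarrow> int \<Rightarrow> 'a) \<times> (nat \<Rightarrow> int \<Rightarrow> 'a)" where
  "ends w = (\<lambda>i. restrict (w i) {-r..<r}, \<lambda>i. restrict (translate L (w i)) {-r..<r})"

lemma ends_path:
  assumes "x \<in> points S"
  shows "ends (path x) = (block (-r) r x, block (-r) r (translate L x))"
  using assms r_pos l_ge
  by (auto simp: ends_def path_def block_def funpow_commute restrict_def fun_eq_iff)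

lemma ends_rot: "ends (rot w) = map_prod rot rot (ends w)"
  by (auto simp: ends_def rot_def fun_eq_iff)

text \<open>Row 0 on [0, l) determines all rows on [r, l - r) by \<open>window\<close>, and the end
  states supply the remaining margins.\<close>

lemma path_eqI:
  assumes "x \<in> points S" "y \<in> points S" "ends (path x) = ends (path y)"
    and "\<And>t. \<lbrakk>-r \<le> t; t < L + r\<rbrakk> \<Longrightarrow> x t = y t"
  shows "path x = path y"
  unfolding path_def block_eq_iff
proof (intro allI ballI)
  fix i t assume t: "t \<in> {-r..<L + r}"
  have e: "block (-r) r x = block (-r) r y" "block (-r) r (translate L x) = block (-r) r (translate L y)"
    using assms by (auto simp: ends_path)
  consider "t < r" | "r \<le> t" "t < L - r" | "L - r \<le> t" by linarith
  then show "(\<phi> ^^ i) x t = (\<phi> ^^ i) y t"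
  proof cases
    case 1
    then show ?thesis using block_eqD[OF e(1)] t by simp
  next
    case 2
    then show ?thesis using assms by (intro window) auto
  next
    case 3
    then show ?thesis
      using block_eqD[OF e(2), of "t - L" i] t assms by (simp add: funpow_commute)
  qed
qed

definition middle :: "(int \<Rightarrow> 'a) set" where
  "middle = (\<Pi>\<^sub>E t\<in>{2*r..<L - 2*r}. S)"

text \<open>The part of row 0 that the two end states do not show, cut into the two constrained
  margins and the free middle.\<close>

definition word :: "(nat \<Rightarrow> int \<Rightarrow> 'a) \<Rightarrow> (int \<Rightarrow> 'a) \<times> (int \<Rightarrow> 'a) \<times> (int \<Rightarrow> 'a)" where
  "word w = (restrict (w 0) {r..<2*r}, restrict (w 0) {2*r..<L - 2*r},
     restrict (translate L (w 0)) {-2*r..<-r})"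

lemma word_path:
  "word (path x) = (restrict x {r..<2*r}, restrict x {2*r..<L - 2*r},
     restrict (translate L x) {-2*r..<-r})"
  using r_pos l_ge by (auto simp: word_def path_def block_def restrict_def fun_eq_iff)

text \<open>This is the independence of past and future given the state. Injectivity: end states and
  word together give row 0, so \<open>path_eqI\<close> applies. Surjectivity: representatives of the
  two margins are spliced around an arbitrary middle.\<close>

lemma bij_betw_word:
  assumes "v \<in> states" "v' \<in> states"
  shows "bij_betw word {w \<in> paths. ends w = (v, v')} (after v \<times> middle \<times> before v')"
  unfolding bij_betw_def
proof (intro conjI inj_onI equalityI subsetI)
  fix w w' assume w: "w \<in> {w \<in> paths. ends w = (v, v')}" and w': "w' \<in> {w \<in> paths. ends w = (v, v')}"
    and eq: "word w = word w'"
  obtain x y where x: "x \<in> points S" "w = path x" and y: "y \<in> points S" "w' = path y"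
    using w w' by (auto simp: paths_def)
  have e: "ends (path x) = ends (path y)" using w w' x y by simp
  have b: "block (-r) r x = block (-r) r y" "block (-r) r (translate L x) = block (-r) r (translate L y)"
    using e x y by (auto simp: ends_path)
  have R: "restrict x {r..<2*r} = restrict y {r..<2*r}"
     "restrict x {2*r..<L - 2*r} = restrict y {2*r..<L - 2*r}"
     "restrict (translate L x) {-2*r..<-r} = restrict (translate L y) {-2*r..<-r}"
    using eq x y by (auto simp: word_path)
  have "x t = y t" if t: "-r \<le> t" "t < L + r" for t
  proof -
    consider "t < r" | "r \<le> t" "t < 2*r" | "2*r \<le> t" "t < L - 2*r"
      | "L - 2*r \<le> t" "t < L - r" | "L - r \<le> t"
      by linarith
    then show ?thesis
    proof cases
      case 1
      then show ?thesis using block_eqD[OF b(1), of t 0] t by simp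
    next
      case 2
      then show ?thesis using restrict_eqD[OF R(1), of t] by simp
    next
      case 3
      then show ?thesis using restrict_eqD[OF R(2), of t] by simp
    next
      case 4
      then show ?thesis using restrict_eqD[OF R(3), of "t - L"] by simp
    next
      case 5
      then show ?thesis using block_eqD[OF b(2), of "t - L" 0] t by simp
    qed
  qed
  then show "w = w'" using path_eqI e x y by simp
next
  fix u assume "u \<in> word ` {w \<in> paths. ends w = (v, v')}"
  then obtain x where x: "x \<in> points S" "ends (path x) = (v, v')" "u = word (path x)"
    by (auto simp: paths_def)
  then have "block (-r) r x = v" "block (-r) r (translate L x) = v'"
    by (auto simp: ends_path)
  moreover have "restrict x {2*r..<L - 2*r} \<in> middle"
    using x(1) by (auto simp: middle_def mem_points_iff)
  ultimately show "u \<in> after v \<times> middle \<times> before v'"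
    unfolding x(3) word_path after_def before_def using x(1) by auto
next
  fix u assume "u \<in> after v \<times> middle \<times> before v'"
  then obtain x y c where x: "x \<in> points S" "block (-r) r x = v"
    and y: "y \<in> points S" "block (-r) r y = v'" and c: "c \<in> middle"
    and u: "u = (restrict x {r..<2*r}, c, restrict y {-2*r..<-r})"
    by (auto simp: after_def before_def)
  \<comment> \<open>The cuts at \<open>2*r\<close> and \<open>L - 2*r\<close> lie outside the
    windows on which the end states depend, so both end states survive the splicing.\<close>
  define z where "z t = (if t < 2*r then x t else if t < L - 2*r then c t else y (t - L))" for t
  have z: "z \<in> points S"
    using x(1) y(1) c by (auto simp: z_def mem_points_iff middle_def PiE_iff)
  have "block (-r) r z = v"
    unfolding x(2)[symmetric] by (rule block_eqI) (use x z in \<open>auto simp: z_def\<close>)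
  moreover have "block (-r) r (translate L z) = v'"
    unfolding y(2)[symmetric] by (rule block_eqI) (use y z l_ge r_pos in \<open>auto simp: z_def\<close>)
  ultimately have "ends (path z) = (v, v')" by (simp add: ends_path z)
  moreover have "word (path z) = u"
    using c l_ge r_pos unfolding word_path u
    by (auto simp: z_def restrict_def fun_eq_iff middle_def PiE_def extensional_def)
  ultimately show "u \<in> word ` {w \<in> paths. ends w = (v, v')}"
    using z by (force simp: paths_def)
qed

subsection \<open>Invariant labels\<close>

abbreviation K :: nat where "K \<equiv> card middle"

lemma finite_middle: "finite middle"
  by (simp add: middle_def finite_PiE finite_S)

lemma K_pos: "0 < K"
  using S_nonempty finite_middle by (simp add: card_gt_0_iff) (simp add: middle_def PiE_eq_empty_iff)

lemma finite_paths: "finite paths"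
  by (simp add: paths_def path_def finite_blocks)

lemma rot_paths: "rot ` paths \<subseteq> paths"
  by (auto simp: paths_def path_def rot_block in_points)

lemma rot_period: "w \<in> paths \<Longrightarrow> (rot ^^ m) w = w"
  by (auto simp: paths_def path_def rot_funpow_block period)

lemma ends_in: "w \<in> paths \<Longrightarrow> ends w \<in> states \<times> states"
  by (auto simp: paths_def ends_path states_def)

lemma free_cyclic_state_pairs: "free_cyclic_on m (states \<times> states) (map_prod rot rot)"
proof -
  have "(map_prod rot rot ^^ i) (v, v') = ((rot ^^ i) v, (rot ^^ i) v')" for i v v'
    by (induction i) auto
  then show ?thesis
    using free_cyclic_states by (auto simp: free_cyclic_on_def)
qed

lemma card_paths_between:
  assumes "v \<in> states" "v' \<in> states"
  shows "card {w \<in> paths. ends w = (v, v')} = card (after v) * (K * card (before v'))"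
  using bij_betw_same_card[OF bij_betw_word[OF assms]] by (simp add: card_cartesian_product)

text \<open>Rotation preserves the number of paths between two states; the common factor
  \<open>K\<close> cancels. The states \<open>v\<close> and \<open>v'\<close> are arbitrary here,
  which is what later allows the two factors to be separated.\<close>

lemma card_extensions_rot:
  assumes "v \<in> states" "v' \<in> states"
  shows "card (after (rot v)) * card (before (rot v')) = card (after v) * card (before v')"
proof -
  have r: "rot v \<in> states" "rot v' \<in> states"
    using assms free_cyclic_states by (auto simp: free_cyclic_on_def)
  have "card {w \<in> paths. ends w = map_prod rot rot (v, v')} = card {w \<in> paths. ends w = (v, v')}"
    by (rule card_fiber_step[OF free_cyclic_state_pairs rot_paths rot_period ends_in])
      (use assms ends_rot in auto)
  then have "K * (card (after (rot v)) * card (before (rot v'))) = K * (card (after v) * card (before v'))"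
    using assms r by (simp add: card_paths_between algebra_simps)
  then show ?thesis using K_pos by simp
qed

lemma bij_betw_rot_states: "bij_betw rot states states"
proof (rule bij_betw_byWitness[where f' = "rot ^^ (m - 1)"])
  have st: "v \<in> states \<Longrightarrow> (rot ^^ m) v = v" "v \<in> states \<Longrightarrow> (rot ^^ i) v \<in> states" for v i
    using free_cyclic_states funpow_in[of rot states v i] by (auto simp: free_cyclic_on_def)
  show "\<forall>v\<in>states. (rot ^^ (m - 1)) (rot v) = v" "\<forall>v\<in>states. rot ((rot ^^ (m - 1)) v) = v"
    using st(1) m_pos by (cases m; simp add: funpow_swap1)+
  show "(rot ^^ (m - 1)) ` states \<subseteq> states" "rot ` states \<subseteq> states"
    using st(2) st(2)[of _ 1] by auto
qed

text \<open>The individual counts are only determined by the path counts up to a scalar, which may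
  depend on the rotation; summing over all states shows that it is 1.\<close>

lemma card_after_rot:
  assumes "v \<in> states"
  shows "card (after (rot v)) = card (after v)"
proof -
  let ?s = "\<Sum>w\<in>states. card (before w)"
  have "card (after (rot v)) * ?s = card (after (rot v)) * (\<Sum>w\<in>states. card (before (rot w)))"
    by (simp add: sum.reindex_bij_betw[OF bij_betw_rot_states, of "\<lambda>w. card (before w)"])
  also have "\<dots> = card (after v) * ?s"
    using assms by (simp add: sum_distrib_left card_extensions_rot)
  finally have "card (after (rot v)) * ?s = card (after v) * ?s" .
  moreover have "0 < ?s"
    using assms finite_states card_before_pos by (intro sum_pos) auto
  ultimately show ?thesis by simp
qed

lemma card_before_rot:
  assumes "v \<in> states"
  shows "card (before (rot v)) = card (before v)"
  using card_extensions_rot[OF assms assms] card_after_rot[OF assms] card_after_pos[OF assms] by simp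

text \<open>The component after the state belongs to the path arriving there, the last two to the
  path leaving it.\<close>

definition symbols :: "((nat \<Rightarrow> int \<Rightarrow> 'a) \<times> nat \<times> nat \<times> nat) set" where
  "symbols = (SIGMA v:states. {..<card (before v)} \<times> {..<card (after v)} \<times> {..<K})"

text \<open>The label set is a product whose factors depend on one end state each, or on none, so a
  label can be divided between the two ends.\<close>

definition labelling :: "((nat \<Rightarrow> int \<Rightarrow> 'a) \<Rightarrow> nat \<times> nat \<times> nat) \<Rightarrow> bool" where
  "labelling lab \<longleftrightarrow> (\<forall>w\<in>paths. lab (rot w) = lab w) \<and>
    (\<forall>v\<in>states. \<forall>v'\<in>states. bij_betw lab {w \<in> paths. ends w = (v, v')}
      ({..<card (after v)} \<times> {..<K} \<times> {..<card (before v')}))"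

text \<open>An instance of \<open>invariant_labelling\<close> over pairs of states; the label sets
  are invariant by \<open>card_after_rot\<close> and \<open>card_before_rot\<close>.\<close>

lemma labelling_exists: "\<exists>lab. labelling lab"
proof -
  let ?D = "\<lambda>(v, v'). {..<card (after v)} \<times> {..<K} \<times> {..<card (before v')}"
  obtain lab where "\<And>w. w \<in> paths \<Longrightarrow> lab (rot w) = lab w"
    "\<And>y. y \<in> states \<times> states \<Longrightarrow> bij_betw lab {w \<in> paths. ends w = y} (?D y)"
  proof (rule invariant_labelling[OF free_cyclic_state_pairs rot_paths rot_period ends_in, where D = ?D])
    show "?D (map_prod rot rot y) = ?D y" if "y \<in> states \<times> states" for y
      using that by (auto simp: card_after_rot card_before_rot)
    show "card {a \<in> paths. ends a = y} = card (?D y)" if "y \<in> states \<times> states" for y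
      using that by (auto simp: card_paths_between card_cartesian_product)
  qed (auto simp: finite_paths ends_rot)
  then have "labelling lab" by (fastforce simp: labelling_def)
  then show ?thesis by blast
qed

subsection \<open>The conjugacy\<close>

definition symbol_at where
  \<comment> \<open>The translate by \<open>-L\<close> gives the path that ends in the current
    state.\<close>
  "symbol_at lab x = (block (-r) r x, snd (snd (lab (path (translate (-L) x)))),
     fst (lab (path x)), fst (snd (lab (path x))))"

definition code where
  "code lab x j = symbol_at lab (translate (j * L) x)"

lemma path_in: "x \<in> points S \<Longrightarrow> path x \<in> paths"
  by (simp add: paths_def)

lemma block_in: "x \<in> points S \<Longrightarrow> block (-r) r x \<in> states"
  by (simp add: states_def)

lemma lab_path_in:
  assumes "labelling lab" "x \<in> points S"
  shows "lab (path x) \<in> {..<card (after (block (-r) r x))} \<times> {..<K} \<times>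
    {..<card (before (block (-r) r (translate L x)))}"
proof -
  have "bij_betw lab {w \<in> paths. ends w = ends (path x)}
      ({..<card (after (block (-r) r x))} \<times> {..<K} \<times> {..<card (before (block (-r) r (translate L x)))})"
    using assms block_in[of x] block_in[of "translate L x"] by (simp add: labelling_def ends_path)
  then show ?thesis
    using path_in[OF assms(2)] by (auto simp: bij_betw_def)
qed

lemma symbol_at_in:
  assumes "labelling lab" "x \<in> points S"
  shows "symbol_at lab x \<in> symbols"
proof -
  have "translate (-L) x \<in> points S" "translate L (translate (-L) x) = x"
    using assms(2) by simp_all
  then show ?thesis
    using lab_path_in[OF assms] lab_path_in[OF assms(1), of "translate (-L) x"] block_in[OF assms(2)]
    by (auto simp: symbol_at_def symbols_def simp del: translate_translate)
qed

lemma code_points: "labelling lab \<Longrightarrow> x \<in> points S \<Longrightarrow> code lab x \<in> points symbols"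
  by (simp add: mem_points_iff code_def symbol_at_in)

lemma symbol_at_rot:
  assumes "labelling lab" "x \<in> points S"
  shows "symbol_at lab (\<phi> x) = map_prod rot id (symbol_at lab x)"
proof -
  have "lab (path (\<phi> y)) = lab (path y)" if "y \<in> points S" for y
    using assms(1) path_in[OF that] by (simp add: labelling_def path_def rot_block[symmetric])
  then show ?thesis
    using assms(2) by (simp add: symbol_at_def rot_block commute[symmetric])
qed

lemma code_rot:
  assumes "labelling lab" "x \<in> points S"
  shows "code lab (\<phi> x) j = map_prod rot id (code lab x j)"
  using assms by (simp add: code_def symbol_at_rot commute[symmetric])

lemma code_translate: "code lab (translate (n * L) x) = translate n (code lab x)"
  by (auto simp: code_def algebra_simps)

lemma labelling_inj:
  assumes "labelling lab" "x \<in> points S" "y \<in> points S"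
    "ends (path x) = ends (path y)" "lab (path x) = lab (path y)"
  shows "path x = path y"
proof -
  have "inj_on lab {w \<in> paths. ends w = ends (path x)}"
    using assms(1,2) block_in[of x] block_in[of "translate L x"]
    by (simp add: labelling_def ends_path bij_betw_def)
  from inj_onD[OF this, of "path x" "path y"] show ?thesis
    using assms path_in by simp
qed

text \<open>Two consecutive symbols contain both end states and the full label of the path between
  them, hence the path itself.\<close>

lemma inj_code:
  assumes lab: "labelling lab"
  shows "inj_on (code lab) (points S)"
proof (rule inj_onI)
  fix x y assume x: "x \<in> points S" and y: "y \<in> points S" and eq: "code lab x = code lab y"
  have sym: "symbol_at lab (translate (j * L) x) = symbol_at lab (translate (j * L) y)" for j
    using fun_cong[OF eq, of j] by (simp add: code_def)
  have path_eq: "path (translate (j * L) x) = path (translate (j * L) y)" for j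
  proof (rule labelling_inj[OF lab])
    have nx: "translate (-L) (translate ((j + 1) * L) z) = translate (j * L) z" 
      "translate L (translate (j * L) z) = translate ((j + 1) * L) z" for z :: "int \<Rightarrow> 'a"
      by (simp_all add: algebra_simps)
    show "ends (path (translate (j * L) x)) = ends (path (translate (j * L) y))"
      using sym[of j] sym[of "j + 1"] x y
      by (simp add: ends_path symbol_at_def nx del: translate_translate)
    show "lab (path (translate (j * L) x)) = lab (path (translate (j * L) y))"
      using sym[of j] sym[of "j + 1"]
      by (simp add: symbol_at_def nx prod_eq_iff del: translate_translate)
  qed (use x y in auto)
  show "x = y"
  proof
    fix t
    \<comment> \<open>Coordinate \<open>t\<close> is seen in row 0 of path number
      \<open>t div L\<close>.\<close>
    have "0 \<le> t mod L" "t mod L < L" using l_ge r_pos by auto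
    then have "translate (t div L * L) x (t mod L) = translate (t div L * L) y (t mod L)"
      using block_eqD[OF path_eq[unfolded path_def], of "t mod L" 0] r_pos
      by (simp del: translate_apply)
    then show "x t = y t" by (simp add: mod_div_mult_eq)
  qed
qed

text \<open>Concatenating row 0 of the given paths on [0, l) is enough: the matching states force
  the other rows to fit as well.\<close>

lemma glue_paths:
  assumes y: "\<And>j. y j \<in> points S"
    and match: "\<And>j. block (-r) r (translate L (y j)) = block (-r) r (y (j + 1))"
  obtains x where "x \<in> points S" "\<And>j. path (translate (j * L) x) = path (y j)"
proof
  define x where "x t = y (t div L) (t mod L)" for t
  show x: "x \<in> points S"
    using y by (simp add: x_def mem_points_iff)
  have L: "0 < L" "r < L" using l_ge r_pos by auto
  have left: "(\<phi> ^^ i) (y (j - 1)) (t + L) = (\<phi> ^^ i) (y j) t" if "- r \<le> t" "t < r" for i j t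
    using block_eqD[OF match[of "j - 1"], of t i] that y by (simp add: funpow_commute)
  have right: "(\<phi> ^^ i) (y (j + 1)) (t - L) = (\<phi> ^^ i) (y j) t" if "L - r \<le> t" "t < L + r" for i j t
    using block_eqD[OF match[of j], of "t - L" i] that y by (simp add: funpow_commute)
  have xt: "x (t + j * L) = y j t" if "0 \<le> t" "t < L" for t j
    using that L by (simp add: x_def)
  \<comment> \<open>Row 0 of the matching states extends the agreement by \<open>r\<close> on both
    sides, just enough for \<open>window\<close> to give all rows on [0, l) in
    \<open>in_mid\<close>. Matching all rows then extends these to the whole path.\<close>
  have xt': "x (t + j * L) = y j t" if "- r \<le> t" "t < L + r" for t j
  proof -
    consider "t < 0" | "0 \<le> t" "t < L" | "L \<le> t" by linarith
    then show ?thesis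
    proof cases
      case 1
      then show ?thesis
        using xt[of "t + L" "j - 1"] left[of t 0 j] that L r_pos by (simp add: algebra_simps)
    next
      case 3
      then show ?thesis
        using xt[of "t - L" "j + 1"] right[of t 0 j] that L r_pos by (simp add: algebra_simps)
    qed (rule xt)
  qed
  have in_mid: "(\<phi> ^^ i) x (t + j * L) = (\<phi> ^^ i) (y j) t" if "0 \<le> t" "t < L" for i t j
  proof -
    have "(\<phi> ^^ i) (translate (j * L) x) t = (\<phi> ^^ i) (y j) t"
      using that x y by (intro window) (auto intro!: xt')
    then show ?thesis using x by (simp add: funpow_commute)
  qed
  show "path (translate (j * L) x) = path (y j)" for j
    unfolding path_def block_eq_iff
  proof (intro allI ballI)
    fix i t assume t: "t \<in> {-r..<L + r}"
    consider "t < 0" | "0 \<le> t" "t < L" | "L \<le> t" by linarith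
    then have "(\<phi> ^^ i) x (t + j * L) = (\<phi> ^^ i) (y j) t"
    proof cases
      case 1
      then show ?thesis
        using in_mid[of "t + L" i "j - 1"] left[of t i j] t L r_pos by (simp add: algebra_simps)
    next
      case 3
      then show ?thesis
        using in_mid[of "t - L" i "j + 1"] right[of t i j] t L r_pos by (simp add: algebra_simps)
    qed (rule in_mid)
    then show "(\<phi> ^^ i) (translate (j * L) x) t = (\<phi> ^^ i) (y j) t"
      using x by (simp add: funpow_commute)
  qed
qed

text \<open>Each pair of neighbouring symbols prescribes the ends and the label of one path; such a
  path exists, and neighbouring paths share a state, so they can be glued.\<close>

lemma code_surj:
  assumes lab: "labelling lab" and s: "s \<in> points symbols"
  shows "s \<in> code lab ` points S"
proof -
  define v b a c where "v j = fst (s j)" and "b j = fst (snd (s j))"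
    and "a j = fst (snd (snd (s j)))" and "c j = snd (snd (snd (s j)))" for j
  have sj: "s j = (v j, b j, a j, c j)" for j
    by (simp add: v_def b_def a_def c_def)
  have mem: "v j \<in> states" "b j < card (before (v j))" "a j < card (after (v j))" "c j < K" for j
    using s by (auto simp: mem_points_iff symbols_def sj dest: spec[of _ j])
  have "\<exists>y\<in>points S. ends (path y) = (v j, v (j + 1)) \<and> lab (path y) = (a j, c j, b (j + 1))" for j
  proof -
    have "(a j, c j, b (j + 1)) \<in> lab ` {w \<in> paths. ends w = (v j, v (j + 1))}"
      using lab mem[of j] mem[of "j + 1"] by (simp add: labelling_def bij_betw_def)
    then show ?thesis by (force simp: paths_def)
  qed
  then obtain y where y: "\<And>j. y j \<in> points S" "\<And>j. ends (path (y j)) = (v j, v (j + 1))"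
    "\<And>j. lab (path (y j)) = (a j, c j, b (j + 1))"
    by metis
  have bl: "block (-r) r (y j) = v j" "block (-r) r (translate L (y j)) = v (j + 1)" for j
    using y(1,2)[of j] by (auto simp: ends_path)
  obtain x where x: "x \<in> points S" "\<And>j. path (translate (j * L) x) = path (y j)"
    using glue_paths[of y] y(1) bl by auto
  have "code lab x j = s j" for j
  proof -
    have "ends (path (translate (j * L) x)) = ends (path (y j))" by (simp add: x)
    then have "block (-r) r (translate (j * L) x) = v j"
      using x(1) by (simp add: ends_path y)
    \<comment> \<open>The component \<open>b j\<close> is stored in path \<open>j - 1\<close>, whose
      label was required to end in \<open>b ((j - 1) + 1)\<close>.\<close>
    moreover have "translate (-L) (translate (j * L) x) = translate ((j - 1) * L) x"
      by (simp add: algebra_simps)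
    ultimately show ?thesis
      by (simp add: code_def symbol_at_def x y sj del: translate_translate)
  qed
  then have "s = code lab x" by auto
  with x(1) show ?thesis by blast
qed

lemma code_local: "\<exists>n. \<forall>x\<in>points S. \<forall>y\<in>points S. agree n x y \<longrightarrow> code lab x j = code lab y j"
proof (intro exI ballI impI)
  \<comment> \<open>Symbol \<open>j\<close> depends on coordinates at distance at most
    \<open>L + 2 * r\<close> from \<open>j * L\<close>, and \<open>2 * r\<close> is less than
    \<open>L\<close>.\<close>
  fix x y assume xy: "x \<in> points S" "y \<in> points S" "agree (nat (\<bar>j * L\<bar> + 2 * L)) x y"
  define x' y' where "x' = translate (j * L) x" and "y' = translate (j * L) y"
  have in': "x' \<in> points S" "y' \<in> points S"
    using xy by (simp_all add: x'_def y'_def)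
  have eq: "x' t = y' t" if "\<bar>t\<bar> \<le> 2 * L" for t
  proof -
    have "\<bar>t + j * L\<bar> \<le> \<bar>j * L\<bar> + 2 * L" using that by linarith
    then show ?thesis using xy(3) by (simp add: agree_def x'_def y'_def)
  qed
  have "block (-r) r x' = block (-r) r y'" "path x' = path y'"
    "path (translate (-L) x') = path (translate (-L) y')"
    unfolding path_def using in' l_ge r_pos by (auto intro!: block_eqI eq)
  then show "code lab x j = code lab y j"
    by (simp add: code_def symbol_at_def x'_def y'_def)
qed

section \<open>The number of symbols and their cycles\<close>

lemma finite_symbols: "finite symbols"
  by (auto simp: symbols_def finite_states)

lemma bij_betw_code:
  assumes "labelling lab"
  shows "bij_betw (code lab) (points S) (points symbols)"
  using inj_code[OF assms] code_points[OF assms] code_surj[OF assms]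
  by (auto simp: bij_betw_def)

text \<open>Both sides count the fixed points of the conjugate maps \<open>\<sigma>\<^sup>l\<close> and \<open>\<sigma>\<close>.\<close>

lemma card_symbols: "card symbols = card S ^ l"
proof -
  obtain lab where lab: "labelling lab" using labelling_exists by blast
  let ?F = "{x \<in> points S. translate L x = x}" and ?G = "{s \<in> points symbols. translate (int 1) s = s}"
  have tr: "code lab (translate L x) = translate 1 (code lab x)" for x
    using code_translate[of lab 1 x] by simp
  have bij: "bij_betw (code lab) (points S) (points symbols)"
    by (rule bij_betw_code[OF lab])
  have "code lab ` ?F = ?G"
  proof (intro equalityI subsetI)
    fix s assume s: "s \<in> ?G"
    then obtain x where x: "x \<in> points S" "s = code lab x"
      using bij by (auto simp: bij_betw_def)
    then have "code lab (translate L x) = code lab x" using s tr by simp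
    then have "translate L x = x" using x bij by (auto simp: bij_betw_def inj_on_eq_iff)
    then show "s \<in> code lab ` ?F" using x by blast
  next
    fix s assume "s \<in> code lab ` ?F"
    then obtain x where "x \<in> points S" "translate L x = x" "s = code lab x" by blast
    then show "s \<in> ?G" using tr[of x] code_points[OF lab, of x] by simp
  qed
  moreover have "inj_on (code lab) ?F"
    by (rule inj_on_subset[OF inj_code[OF lab]]) auto
  ultimately have "card ?F = card ?G"
    using card_image by fastforce
  moreover have "0 < l" using l_ge r_pos by linarith
  ultimately show ?thesis
    using card_periodic_points[OF finite_S, of l] card_periodic_points[OF finite_symbols, of 1] by simp
qed

text \<open>The position of the state maps the symbols equivariantly to Z/m. The \<open>m\<close>
  fibres have equal size, so this size is \<open>card S ^ l div m\<close>, and an invariant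
  labelling of the fibres names the cycles.\<close>

lemma symbols_relabelling:
  obtains h where "bij_betw h symbols ({..<m} \<times> {..<card S ^ l div m})"
    "\<And>s. s \<in> symbols \<Longrightarrow> h (map_prod rot id s) = rotate_symbol m (h s)"
proof -
  obtain pos where pos: "\<And>v. v \<in> states \<Longrightarrow> pos v < m"
    "\<And>v. v \<in> states \<Longrightarrow> pos (rot v) = Suc (pos v) mod m"
    using free_cyclic_on_position[OF free_cyclic_states] by blast
  let ?f = "map_prod rot id" and ?g = "\<lambda>i. Suc i mod m" and ?p = "\<lambda>s. pos (fst s)"
  have rot_states: "rot v \<in> states" "(rot ^^ m) v = v" if "v \<in> states" for v
    using free_cyclic_states that by (auto simp: free_cyclic_on_def)
  have f: "?f ` symbols \<subseteq> symbols"
    by (auto simp: symbols_def rot_states card_after_rot card_before_rot)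
  have fi: "(?f ^^ i) s = ((rot ^^ i) (fst s), snd s)" for i and s :: "(nat \<Rightarrow> int \<Rightarrow> 'a) \<times> nat \<times> nat \<times> nat"
    by (induction i) auto
  have fm: "(?f ^^ m) s = s" if "s \<in> symbols" for s
    using that rot_states(2) by (auto simp: fi symbols_def)
  have gi: "(?g ^^ i) j = (i + j) mod m" if "j < m" for i j
    using that by (induction i) (auto simp: mod_Suc_eq)
  have base: "free_cyclic_on m {..<m} ?g"
  proof -
    have "(?g ^^ i) j = j \<longleftrightarrow> m dvd i" if "j < m" for i j
    proof -
      have "(i + j) mod m = j \<longleftrightarrow> (i + j) mod m = (0 + j) mod m" using that by simp
      also have "\<dots> \<longleftrightarrow> m dvd i" by (subst mod_eq_dvd_iff_nat) auto
      finally show ?thesis by (simp add: gi[OF that])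
    qed
    then show ?thesis using m_pos by (auto simp: free_cyclic_on_def)
  qed
  have p: "?p s \<in> {..<m}" "?p (?f s) = ?g (?p s)" if "s \<in> symbols" for s
    using that pos by (auto simp: symbols_def)
  define n where "n = card {s \<in> symbols. ?p s = 0}"
  have fiber: "card {s \<in> symbols. ?p s = i} = n" if "i < m" for i
    using that
  proof (induction i)
    case (Suc i)
    then have "card {s \<in> symbols. ?p s = ?g i} = card {s \<in> symbols. ?p s = i}"
      by (intro card_fiber_step[OF base f fm, where p = ?p]) (use p in auto)
    with Suc show ?case by simp
  qed (simp add: n_def)
  have "card symbols = (\<Sum>i<m. card {s \<in> symbols. ?p s = i})"
  proof -
    have "symbols = (\<Union>i<m. {s \<in> symbols. ?p s = i})" using p(1) by auto
    then show ?thesis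
      using card_UN_disjoint[of "{..<m}" "\<lambda>i. {s \<in> symbols. ?p s = i}"] finite_symbols by auto
  qed
  then have n: "n = card S ^ l div m"
    using fiber m_pos by (simp add: card_symbols)
  obtain lab where lab: "\<And>s. s \<in> symbols \<Longrightarrow> lab (?f s) = lab s"
    "\<And>i. i \<in> {..<m} \<Longrightarrow> bij_betw lab {s \<in> symbols. ?p s = i} {..<n}"
    by (rule invariant_labelling[OF base f fm, where p = ?p and D = "\<lambda>_. {..<n}"])
      (use p finite_symbols fiber in auto)
  have "bij_betw (\<lambda>s. (?p s, lab s)) symbols ({..<m} \<times> {..<n})"
    unfolding bij_betw_def
  proof (intro conjI inj_onI equalityI subsetI)
    fix s t assume st: "s \<in> symbols" "t \<in> symbols" "(?p s, lab s) = (?p t, lab t)"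
    then have "inj_on lab {u \<in> symbols. ?p u = ?p s}"
      using lab(2) p(1) by (simp add: bij_betw_def)
    then show "s = t" using st by (elim inj_onD) auto
  next
    fix u assume "u \<in> (\<lambda>s. (?p s, lab s)) ` symbols"
    then obtain s where s: "s \<in> symbols" "u = (?p s, lab s)" by blast
    then have "lab s \<in> {..<n}" using lab(2)[of "?p s"] p(1) by (auto simp: bij_betw_def)
    then show "u \<in> {..<m} \<times> {..<n}" using s p(1) by auto
  next
    fix u assume "u \<in> {..<m} \<times> {..<n}"
    then obtain i d where u: "u = (i, d)" "i < m" "d < n" by auto
    then have "d \<in> lab ` {s \<in> symbols. ?p s = i}" using lab(2)[of i] by (simp add: bij_betw_def)
    then show "u \<in> (\<lambda>s. (?p s, lab s)) ` symbols" using u by auto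
  qed
  moreover have "(?p (?f s), lab (?f s)) = rotate_symbol m (?p s, lab s)" if "s \<in> symbols" for s
    using that p lab(1) by (simp add: rotate_symbol_def)
  ultimately show thesis by (intro that) (use n in auto)
qed

lemma power_conjugate_to_rotation:
  "\<exists>\<theta>. homeomorphic_map (full_shift S) (full_shift ({..<m} \<times> {..<card S ^ l div m})) \<theta> \<and>
    (\<forall>x\<in>points S. \<theta> (\<phi> x) = rotate_symbol m \<circ> \<theta> x) \<and>
    (\<forall>x\<in>points S. \<theta> (translate L x) = translate 1 (\<theta> x))"
proof -
  let ?T = "{..<m} \<times> {..<card S ^ l div m}"
  obtain lab where lab: "labelling lab" using labelling_exists by blast
  obtain h where h: "bij_betw h symbols ?T"
    "\<And>s. s \<in> symbols \<Longrightarrow> h (map_prod rot id s) = rotate_symbol m (h s)"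
    using symbols_relabelling by blast
  \<comment> \<open>The relabelling acts on each symbol separately, so it commutes with the shift
    and preserves locality.\<close>
  define \<theta> where "\<theta> x = h \<circ> code lab x" for x
  have bij_h: "bij_betw ((\<circ>) h) (points symbols) (points ?T)"
  proof (rule bij_betw_byWitness[where f' = "(\<circ>) (inv_into symbols h)"])
    show "\<forall>s\<in>points symbols. inv_into symbols h \<circ> (h \<circ> s) = s"
      using h(1) by (auto simp: mem_points_iff fun_eq_iff bij_betw_def)
    show "\<forall>s\<in>points ?T. h \<circ> (inv_into symbols h \<circ> s) = s"
      using bij_betw_inv_into_right[OF h(1)] by (auto simp: mem_points_iff fun_eq_iff)
    show "(\<circ>) h ` points symbols \<subseteq> points ?T"
      using bij_betwE[OF h(1)] by (auto simp: mem_points_iff)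
    show "(\<circ>) (inv_into symbols h) ` points ?T \<subseteq> points symbols"
    proof (rule image_subsetI)
      fix s assume "s \<in> points ?T"
      then have "s i \<in> ?T" for i by (simp only: mem_points_iff)
      then have "inv_into symbols h (s i) \<in> symbols" for i
        using bij_betwE[OF bij_betw_inv_into[OF h(1)]] by blast
      then show "inv_into symbols h \<circ> s \<in> points symbols"
        by (simp add: mem_points_iff)
    qed
  qed
  have "bij_betw \<theta> (points S) (points ?T)"
    using bij_betw_trans[OF bij_betw_code[OF lab] bij_h] by (simp add: \<theta>_def[abs_def] comp_def)
  moreover have "\<exists>n. \<forall>x\<in>points S. \<forall>y\<in>points S. agree n x y \<longrightarrow> \<theta> x j = \<theta> y j" for j
    using code_local[of lab j] unfolding \<theta>_def comp_def by metis
  ultimately have "homeomorphic_map (full_shift S) (full_shift ?T) \<theta>"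
    by (rule homeomorphic_map_full_shiftI[OF finite_S])
  moreover have "\<theta> (\<phi> x) = rotate_symbol m \<circ> \<theta> x" if "x \<in> points S" for x
    using code_points[OF lab that] that
    by (auto simp: \<theta>_def fun_eq_iff code_rot[OF lab] h(2) mem_points_iff)
  moreover have "\<theta> (translate L x) = translate 1 (\<theta> x)" for x
    using code_translate[of lab 1 x] by (simp add: \<theta>_def fun_eq_iff)
  ultimately show ?thesis by blast
qed

end

section \<open>Conjugacy of the two automorphisms\<close>

lemma continuous_map_funpow:
  "continuous_map X X f \<Longrightarrow> continuous_map X X (f ^^ i)"
proof (induction i)
  case (Suc i)
  then show ?case using continuous_map_compose[of X X "f ^^ i" X f] by (simp add: comp_def)
qed (simp add: id_def)

text \<open>Only the powers below \<open>m\<close> matter. Each is a block code with some radius,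
  and each non-trivial one has no fixed point, so by compactness it changes a coordinate within a
  bounded distance of 0.\<close>

lemma shift_automorphism_window:
  assumes "finite S" "S \<noteq> {}" "0 < m" and aut: "shift_automorphism S \<phi>"
    and orbits: "\<forall>x\<in>points S. card (orbit_on (points S) \<phi> x) = m"
  shows "\<exists>r. cyclic_shift_action S m \<phi> r"
proof -
  have cont: "continuous_map (full_shift S) (full_shift S) \<phi>"
    and bij: "bij_betw \<phi> (points S) (points S)"
    and com: "\<And>x. x \<in> points S \<Longrightarrow> \<phi> (shift x) = shift (\<phi> x)"
    using aut by (auto simp: shift_automorphism_def bij_betw_def homeomorphic_eq_everything_map)
  have pts: "(\<phi> ^^ i) x \<in> points S" if "x \<in> points S" for i x
    using funpow_in[of \<phi> "points S" x i] bij that by (auto simp: bij_betw_def)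
  have comi: "(\<phi> ^^ i) (shift x) = shift ((\<phi> ^^ i) x)" if "x \<in> points S" for i x
    by (induction i) (use that pts com in auto)
  have per: "(\<phi> ^^ i) x = x \<longleftrightarrow> m dvd i" if "x \<in> points S" for i x
    by (rule funpow_eq_iff_dvd_card_orbit[OF bij that]) (use orbits that assms(3) in auto)
  have mod: "(\<phi> ^^ i) x = (\<phi> ^^ (i mod m)) x" if "x \<in> points S" for i x
  proof -
    have "(\<phi> ^^ m) x = x" using per[OF that, of m] by simp
    then show ?thesis by (simp add: funpow_mod_eq)
  qed
  have "\<exists>n. \<forall>x\<in>points S. \<forall>y\<in>points S. \<forall>t.
      (\<forall>s\<in>{t - int n..t + int n}. x s = y s) \<longrightarrow> (\<phi> ^^ i) x t = (\<phi> ^^ i) y t" for i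
    by (rule sliding_block_window[OF assms(1) continuous_map_funpow[OF cont] comi])
  then obtain n where n: "\<And>i x y t. \<lbrakk>x \<in> points S; y \<in> points S;
      \<forall>s\<in>{t - int (n i)..t + int (n i)}. x s = y s\<rbrakk> \<Longrightarrow> (\<phi> ^^ i) x t = (\<phi> ^^ i) y t"
    by metis
  have "\<exists>k. \<forall>x\<in>points S. \<exists>t. \<bar>t\<bar> \<le> int k \<and> (\<phi> ^^ i) x t \<noteq> x t" if i: "\<not> m dvd i" for i
  proof (rule uniform_on_full_shift[OF assms(1)])
    fix x assume x: "x \<in> points S"
    then obtain t where t: "(\<phi> ^^ i) x t \<noteq> x t"
      using per[OF x, of i] i by auto
    \<comment> \<open>The radius contains the window of size \<open>n i\<close> around
      \<open>t\<close>, so the change at \<open>t\<close> is shared by all nearby points.\<close>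
    have "\<bar>t\<bar> \<le> int (nat \<bar>t\<bar> + n i) \<and> (\<phi> ^^ i) y t \<noteq> y t"
      if "y \<in> points S" "agree (nat \<bar>t\<bar> + n i) x y" for y
    proof -
      have "(\<phi> ^^ i) x t = (\<phi> ^^ i) y t" "x t = y t"
        using that x by (auto simp: agree_def intro!: n)
      then show ?thesis using t by simp
    qed
    then show "\<exists>k. \<forall>y\<in>points S. agree k x y \<longrightarrow> (\<exists>t. \<bar>t\<bar> \<le> int k \<and> (\<phi> ^^ i) y t \<noteq> y t)"
      by blast
  next
    fix k k' :: nat and x
    assume "\<exists>t. \<bar>t\<bar> \<le> int k \<and> (\<phi> ^^ i) x t \<noteq> x t" "k \<le> k'"
    then show "\<exists>t. \<bar>t\<bar> \<le> int k' \<and> (\<phi> ^^ i) x t \<noteq> x t"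
      by (meson of_nat_mono order_trans)
  qed
  then obtain k where k: "\<And>i x. \<not> m dvd i \<Longrightarrow> x \<in> points S \<Longrightarrow> \<exists>t. \<bar>t\<bar> \<le> int (k i) \<and> (\<phi> ^^ i) x t \<noteq> x t"
    by metis
  \<comment> \<open>The sum dominates every single bound; the added 1 makes the bounds strict, as
    the half-open window {-r..<r} requires, and ensures \<open>0 < r\<close>.\<close>
  define r where "r = 1 + (\<Sum>i<m. int (n i) + int (k i))"
  have nk: "int (n i) + int (k i) < r" if "i < m" for i
    using member_le_sum[of i "{..<m}" "\<lambda>i. int (n i) + int (k i)"] that by (simp add: r_def)
  have "cyclic_shift_action S m \<phi> r"
  proof
    show "0 < r" unfolding r_def by (intro add_pos_nonneg sum_nonneg) auto
    show "\<phi> x \<in> points S" if "x \<in> points S" for x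
      using pts[OF that, of 1] by simp
    show "\<phi> (translate n x) = translate n (\<phi> x)" if "x \<in> points S" for x n
      using commute_translate[of S \<phi>] com that by blast
    show "(\<phi> ^^ m) x = x" if "x \<in> points S" for x
      using per[OF that, of m] by simp
    show "(\<phi> ^^ i) x t = (\<phi> ^^ i) y t"
      if "x \<in> points S" "y \<in> points S" "\<forall>s\<in>{t - r..t + r}. x s = y s" for x y t i
    proof -
      have "i mod m < m" using assms(3) by simp
      from nk[OF this] have "(\<phi> ^^ (i mod m)) x t = (\<phi> ^^ (i mod m)) y t"
        using that by (intro n) auto
      then show ?thesis using mod that(1,2) by metis
    qed
    show "m dvd i" if x: "x \<in> points S" and eq: "\<forall>t\<in>{-r..<r}. (\<phi> ^^ i) x t = x t" for x i
    proof (rule ccontr)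
      assume "\<not> m dvd i"
      then have "\<not> m dvd i mod m" by (simp add: dvd_mod_iff)
      then obtain t where t: "\<bar>t\<bar> \<le> int (k (i mod m))" "(\<phi> ^^ (i mod m)) x t \<noteq> x t"
        using k x by blast
      have "i mod m < m" using assms(3) by simp
      from nk[OF this] have "t \<in> {-r..<r}" using t(1) by auto
      then have "(\<phi> ^^ i) x t = x t" using eq by blast
      then show False using t(2) mod[OF x, of i] by simp
    qed
  qed (use assms in auto)
  then show ?thesis by blast
qed

lemma eventually_power_conjugate_to_rotation:
  assumes "finite S" "S \<noteq> {}" "0 < m" "shift_automorphism S \<phi>"
    and "\<forall>x\<in>points S. card (orbit_on (points S) \<phi> x) = m"
  shows "\<forall>\<^sub>F l in sequentially.
    \<exists>\<theta>. homeomorphic_map (full_shift S) (full_shift ({..<m} \<times> {..<card S ^ l div m})) \<theta> \<and>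
      (\<forall>x\<in>points S. \<theta> (\<phi> x) = rotate_symbol m \<circ> \<theta> x) \<and>
      (\<forall>x\<in>points S. \<theta> ((shift ^^ l) x) = shift (\<theta> x))"
proof -
  obtain r where "cyclic_shift_action S m \<phi> r"
    using shift_automorphism_window[OF assms] by blast
  then interpret cyclic_shift_action S m \<phi> r .
  show ?thesis
    unfolding shift_funpow unfolding shift_eq_translate
  \<comment> \<open>The radius was fixed before \<open>l\<close>, so this threshold depends on the
    automorphism only.\<close>
  proof (rule eventually_sequentiallyI[of "nat (4 * r)"])
    fix l assume "nat (4 * r) \<le> l"
    then have "4 * r \<le> int l" by linarith
    then interpret cyclic_shift_action_power S m \<phi> r l
      by unfold_locales
    show "\<exists>\<theta>. homeomorphic_map (full_shift S) (full_shift ({..<m} \<times> {..<card S ^ l div m})) \<theta> \<and>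
      (\<forall>x\<in>points S. \<theta> (\<phi> x) = rotate_symbol m \<circ> \<theta> x) \<and>
      (\<forall>x\<in>points S. \<theta> (translate (int l) x) = translate 1 (\<theta> x))"
      by (rule power_conjugate_to_rotation)
  qed
qed

text \<open>The map is \<open>\<theta>1\<close> followed by the inverse of \<open>\<theta>2\<close>.
  The maps \<open>f1\<close>, \<open>f2\<close>, \<open>g\<close> are quantified after \<psi>, so
  that one homeomorphism can intertwine several pairs at once.\<close>

lemma homeomorphic_map_transport:
  assumes "homeomorphic_map X Y \<theta>1" "homeomorphic_map Z Y \<theta>2"
  obtains \<psi> where "homeomorphic_map X Z \<psi>"
    "\<And>f1 f2 g. \<lbrakk>f1 ` topspace X \<subseteq> topspace X; f2 ` topspace Z \<subseteq> topspace Z;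
      \<forall>x\<in>topspace X. \<theta>1 (f1 x) = g (\<theta>1 x); \<forall>x\<in>topspace Z. \<theta>2 (f2 x) = g (\<theta>2 x)\<rbrakk>
      \<Longrightarrow> \<forall>x\<in>topspace X. \<psi> (f1 x) = f2 (\<psi> x)"
proof -
  obtain \<eta> where \<eta>: "homeomorphic_maps Z Y \<theta>2 \<eta>"
    using assms(2) homeomorphic_map_maps by blast
  have "homeomorphic_map Y Z \<eta>"
    using \<eta> by (simp add: homeomorphic_maps_map)
  with assms(1) have hom: "homeomorphic_map X Z (\<eta> \<circ> \<theta>1)"
    by (rule homeomorphic_map_compose)
  have \<eta>': "\<theta>2 (\<eta> y) = y" if "y \<in> topspace Y" for y
    using \<eta> that by (simp add: homeomorphic_maps_def)
  have \<eta>\<theta>: "\<eta> (\<theta>2 z) = z" if "z \<in> topspace Z" for z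
    using \<eta> that by (simp add: homeomorphic_maps_def)
  have im: "\<theta>1 x \<in> topspace Y" "\<eta> (\<theta>1 x) \<in> topspace Z" if "x \<in> topspace X" for x
    using that assms(1) homeomorphic_imp_surjective_map hom by fastforce+
  show thesis
  proof (rule that[OF hom], intro ballI)
    fix f1 f2 g x
    assume *: "f1 ` topspace X \<subseteq> topspace X" "f2 ` topspace Z \<subseteq> topspace Z"
      "\<forall>x\<in>topspace X. \<theta>1 (f1 x) = g (\<theta>1 x)" "\<forall>x\<in>topspace Z. \<theta>2 (f2 x) = g (\<theta>2 x)"
      and x: "x \<in> topspace X"
    have "\<theta>2 (f2 (\<eta> (\<theta>1 x))) = \<theta>1 (f1 x)"
      using * x im \<eta>' by simp
    moreover have "f2 (\<eta> (\<theta>1 x)) \<in> topspace Z"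
      using * x im by blast
    ultimately show "(\<eta> \<circ> \<theta>1) (f1 x) = f2 ((\<eta> \<circ> \<theta>1) x)"
      using \<eta>\<theta> by (metis comp_apply)
  qed
qed

theorem corollary6p3:
  fixes S :: "'a set" and k m :: nat
    and \<phi>1 \<phi>2 :: "(int \<Rightarrow> 'a) \<Rightarrow> (int \<Rightarrow> 'a)"
  assumes "k \<ge> 1" and "m \<ge> 1" and "card S = k"
    and "shift_automorphism S \<phi>1" and "shift_automorphism S \<phi>2"
    and "\<forall>x \<in> topspace (full_shift S). card (orbit_on (topspace (full_shift S)) \<phi>1 x) = m"
    and "\<forall>x \<in> topspace (full_shift S). card (orbit_on (topspace (full_shift S)) \<phi>2 x) = m"
  shows "\<forall>\<^sub>F l in sequentially.
    \<exists>\<psi>. homeomorphic_map (full_shift S) (full_shift S) \<psi> \<and>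
      (\<forall>x \<in> topspace (full_shift S). \<psi> (\<phi>1 x) = \<phi>2 (\<psi> x)) \<and>
      (\<forall>x \<in> topspace (full_shift S). \<psi> ((shift ^^ l) x) = (shift ^^ l) (\<psi> x))"
proof -
  have S: "finite S" "S \<noteq> {}" "0 < m"
    using assms(1-3) by (auto intro: card_ge_0_finite)
  have in_points: "\<phi>1 ` points S \<subseteq> points S" "\<phi>2 ` points S \<subseteq> points S"
    using assms(4,5) by (auto simp: shift_automorphism_def homeomorphic_eq_everything_map)
  have shift_points: "(shift ^^ l) ` points S \<subseteq> points S" for l
    by (auto simp: shift_funpow)
  show ?thesis
    using eventually_power_conjugate_to_rotation[OF S assms(4,6)]
      eventually_power_conjugate_to_rotation[OF S assms(5,7)]
  proof eventually_elim
    case (elim l)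
    let ?Y = "full_shift ({..<m} \<times> {..<card S ^ l div m})"
    obtain \<theta>1 \<theta>2 where
      \<theta>1: "homeomorphic_map (full_shift S) ?Y \<theta>1" "\<forall>x\<in>points S. \<theta>1 (\<phi>1 x) = rotate_symbol m \<circ> \<theta>1 x"
        "\<forall>x\<in>points S. \<theta>1 ((shift ^^ l) x) = shift (\<theta>1 x)" and
      \<theta>2: "homeomorphic_map (full_shift S) ?Y \<theta>2" "\<forall>x\<in>points S. \<theta>2 (\<phi>2 x) = rotate_symbol m \<circ> \<theta>2 x"
        "\<forall>x\<in>points S. \<theta>2 ((shift ^^ l) x) = shift (\<theta>2 x)"
      using elim by blast
    obtain \<psi> where \<psi>: "homeomorphic_map (full_shift S) (full_shift S) \<psi>"
      "\<And>f1 f2 g. \<lbrakk>f1 ` points S \<subseteq> points S; f2 ` points S \<subseteq> points S;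
        \<forall>x\<in>points S. \<theta>1 (f1 x) = g (\<theta>1 x); \<forall>x\<in>points S. \<theta>2 (f2 x) = g (\<theta>2 x)\<rbrakk>
        \<Longrightarrow> \<forall>x\<in>points S. \<psi> (f1 x) = f2 (\<psi> x)"
      using homeomorphic_map_transport[OF \<theta>1(1) \<theta>2(1)] by blast
    \<comment> \<open>The same \<psi> is used twice: on the model, \<open>g\<close> is first the
      symbolwise rotation, then the shift.\<close>
    have "\<forall>x\<in>points S. \<psi> (\<phi>1 x) = \<phi>2 (\<psi> x)"
      using in_points \<theta>1(2) \<theta>2(2) by (intro \<psi>(2)[where g = "(\<circ>) (rotate_symbol m)"])
    moreover have "\<forall>x\<in>points S. \<psi> ((shift ^^ l) x) = (shift ^^ l) (\<psi> x)"
      using shift_points \<theta>1(3) \<theta>2(3) by (intro \<psi>(2)[where g = shift])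
    ultimately show ?case using \<psi>(1) by blast
  qed
qed

end
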